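(* Suppose $X^+=\mathcal A^{\mathbb N_0}$ is a one-sided full shift and $X_0^+$ is a proper subshift of $X^+$. Then the potential $\phi^+:X^+\to\mathbb R$ defined by $\phi^+(x)=0$ if $x\in X_0^+$ and $\phi^+(x)=-a_j$ if $\mathrm{dist}(x,X_0^+)=2^{-j}$ has a freezing phase transition with $\mathrm{ZTA}(\phi^+)$ consisting of measures of maximal entropy of $X_0^+$ provided the decreasing sequence $(a_j)$ satisfies \[ a_{3j}\ge \frac{2\log j}{j}+\frac{1}{j}\sum_{i=0}^{\lfloor \log_2 j\rfloor}2^i\kappa_{i} +\frac{1}{j}, \] where $\kappa_i=\frac{\log |\mathcal L_{2^i}(X_0^+)|}{2^i}-h_{\mathrm{top}}(X_0^+)$.
   Context: $\mathcal A$ finite; $\mathrm{dist}(x,y)=2^{-n}$ where $n$ is the first index at which $x,y$ differ. $\mathcal L_m(X_0^+)$ is the set of words of length $m$ appearing in $X_0^+$; $h_{\mathrm{top}}$ is topological entropy. Equilibrium states of $\beta\phi^+$: shift-invariant probability measures maximizing $h(\mu)+\beta\int\phi^+d\mu$ ($h$ = measure-theoretic entropy). Freezing phase transition at $\beta_c$: equilibrium state sets equal for all $\beta,\beta'>\beta_c$ and different for $\beta<\beta_c<\beta'$. $\mathrm{ZTA}(\phi^+)$ is the set of vague limits of $\mu_n\in\mathrm{ES}(\beta_n\phi^+)$ with $\beta_n\to\infty$. *)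

theory Defs
  imports "HOL-Probability.Probability"
begin

text \<open>Points of the one-sided full shift are sequences nat => 'a; the alphabet is
the finite type 'a.\<close>

definition shift :: "(nat \<Rightarrow> 'a) \<Rightarrow> (nat \<Rightarrow> 'a)" where
  "shift x = (\<lambda>i. x (Suc i))"

definition sdist :: "(nat \<Rightarrow> 'a) \<Rightarrow> (nat \<Rightarrow> 'a) \<Rightarrow> real" where
  "sdist x y = (if x = y then 0 else (1/2) ^ (LEAST n. x n \<noteq> y n))"

definition setdist :: "(nat \<Rightarrow> 'a) \<Rightarrow> (nat \<Rightarrow> 'a) set \<Rightarrow> real" where
  "setdist x S = (INF y\<in>S. sdist x y)"

definition sclosed :: "(nat \<Rightarrow> 'a) set \<Rightarrow> bool" where
  "sclosed S \<longleftrightarrow> (\<forall>x. (\<forall>e>0. \<exists>y\<in>S. sdist x y < e) \<longrightarrow> x \<in> S)"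

definition scontinuous :: "((nat \<Rightarrow> 'a) \<Rightarrow> real) \<Rightarrow> bool" where
  "scontinuous f \<longleftrightarrow> (\<forall>x. \<forall>e>0. \<exists>d>0. \<forall>y. sdist x y < d \<longrightarrow> \<bar>f y - f x\<bar> < e)"

definition subshift :: "(nat \<Rightarrow> 'a) set \<Rightarrow> bool" where
  "subshift X \<longleftrightarrow> X \<noteq> {} \<and> sclosed X \<and> shift ` X \<subseteq> X"

definition lang :: "nat \<Rightarrow> (nat \<Rightarrow> 'a) set \<Rightarrow> 'a list set" where
  "lang m X = {map (\<lambda>i. x (k + i)) [0..<m] | x k. x \<in> X}"

definition htop :: "(nat \<Rightarrow> 'a) set \<Rightarrow> real" where
  "htop X = lim (\<lambda>m. ln (real (card (lang m X))) / real m)"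

text \<open>Borel sigma-algebra of the product of discrete spaces.\<close>
definition SM :: "(nat \<Rightarrow> 'a) measure" where
  "SM = Pi\<^sub>M UNIV (\<lambda>_. count_space UNIV)"

definition inv_probs :: "(nat \<Rightarrow> 'a) measure set" where
  "inv_probs = {\<mu>. sets \<mu> = sets SM \<and> prob_space \<mu> \<and>
      (\<forall>A\<in>sets SM. emeasure \<mu> (shift -` A) = emeasure \<mu> A)}"

definition fin_partitions :: "(nat \<Rightarrow> 'a) measure \<Rightarrow> (nat \<Rightarrow> 'a) set set set" where
  "fin_partitions \<mu> = {P. finite P \<and> P \<subseteq> sets \<mu> \<and> \<Union>P = space \<mu> \<and>
      (\<forall>A\<in>P. \<forall>B\<in>P. A \<noteq> B \<longrightarrow> A \<inter> B = {})}"

definition join_entropy :: "(nat \<Rightarrow> 'a) measure \<Rightarrow> (nat \<Rightarrow> 'a) set set \<Rightarrow> nat \<Rightarrow> real" where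
  "join_entropy \<mu> P n = - (\<Sum>w\<in>PiE {0..<n} (\<lambda>_. P).
      let C = space \<mu> \<inter> (\<Inter>i\<in>{0..<n}. (shift ^^ i) -` (w i)) in measure \<mu> C * ln (measure \<mu> C))"

definition part_entropy :: "(nat \<Rightarrow> 'a) measure \<Rightarrow> (nat \<Rightarrow> 'a) set set \<Rightarrow> real" where
  "part_entropy \<mu> P = lim (\<lambda>n. join_entropy \<mu> P n / real n)"

definition ks_entropy :: "(nat \<Rightarrow> 'a) measure \<Rightarrow> real" where
  "ks_entropy \<mu> = (SUP P\<in>fin_partitions \<mu>. part_entropy \<mu> P)"

definition eq_states :: "real \<Rightarrow> ((nat \<Rightarrow> 'a) \<Rightarrow> real) \<Rightarrow> (nat \<Rightarrow> 'a) measure set" where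
  "eq_states \<beta> \<phi> = {\<mu>\<in>inv_probs. \<forall>\<nu>\<in>inv_probs.
      ks_entropy \<nu> + \<beta> * integral\<^sup>L \<nu> \<phi> \<le> ks_entropy \<mu> + \<beta> * integral\<^sup>L \<mu> \<phi>}"

definition freezing_phase_transition :: "((nat \<Rightarrow> 'a) \<Rightarrow> real) \<Rightarrow> real \<Rightarrow> bool" where
  "freezing_phase_transition \<phi> \<beta>c \<longleftrightarrow>
     (\<forall>\<beta> \<beta>'. \<beta> > \<beta>c \<longrightarrow> \<beta>' > \<beta>c \<longrightarrow> eq_states \<beta> \<phi> = eq_states \<beta>' \<phi>) \<and>
     (\<forall>\<beta> \<beta>'. \<beta> < \<beta>c \<longrightarrow> \<beta>c < \<beta>' \<longrightarrow> eq_states \<beta> \<phi> \<noteq> eq_states \<beta>' \<phi>)"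

definition vague_limit :: "(nat \<Rightarrow> (nat \<Rightarrow> 'a) measure) \<Rightarrow> (nat \<Rightarrow> 'a) measure \<Rightarrow> bool" where
  "vague_limit \<mu> \<nu> \<longleftrightarrow> (\<forall>f. scontinuous f \<longrightarrow>
      (\<lambda>n. integral\<^sup>L (\<mu> n) f) \<longlonglongrightarrow> integral\<^sup>L \<nu> f)"

definition ZTA :: "((nat \<Rightarrow> 'a) \<Rightarrow> real) \<Rightarrow> (nat \<Rightarrow> 'a) measure set" where
  "ZTA \<phi> = {\<nu>. sets \<nu> = sets SM \<and> prob_space \<nu> \<and>
      (\<exists>\<beta> \<mu>. filterlim \<beta> at_top sequentially \<and> (\<forall>n. \<mu> n \<in> eq_states (\<beta> n) \<phi>) \<and>
              vague_limit \<mu> \<nu>)}"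

definition MME :: "(nat \<Rightarrow> 'a) set \<Rightarrow> (nat \<Rightarrow> 'a) measure set" where
  "MME X = {\<mu>\<in>inv_probs. measure \<mu> X = 1 \<and>
      (\<forall>\<nu>\<in>inv_probs. measure \<nu> X = 1 \<longrightarrow> ks_entropy \<nu> \<le> ks_entropy \<mu>)}"

definition pot :: "(nat \<Rightarrow> real) \<Rightarrow> (nat \<Rightarrow> 'a) set \<Rightarrow> (nat \<Rightarrow> 'a) \<Rightarrow> real" where
  "pot a X0 x = (if x \<in> X0 then 0 else - a (THE j. setdist x X0 = (1/2) ^ j))"

definition kappa :: "(nat \<Rightarrow> 'a) set \<Rightarrow> nat \<Rightarrow> real" where
  "kappa X0 i = ln (real (card (lang (2^i) X0))) / 2^i - htop X0"

end

theory Submission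
  imports Defs "HOL-Real_Asymp.Real_Asymp"
begin

text \<open>Parse a word from left to right into blocks of lengths \<open>1, 2, 4, \<dots>\<close>, starting afresh as soon as
  a block leaves the language of \<open>X0\<close>. If the first bad block is preceded by blocks of total length
  \<open>j = 2\<^sup>i - 1\<close>, then each of those \<open>j\<close> positions pays at least \<open>a (2 * j) \<ge> a (3 * j)\<close>, and the
  hypothesis makes \<open>j * a (3 * j)\<close> outweigh the excess
  \<open>\<Sum>k<i. 2\<^sup>k * kappa X0 k\<close> of the number of such \<open>j\<close>-words over \<open>exp (j * htop X0)\<close>, with a summable
  remainder. Hence the partition function at a suitable \<open>\<beta>\<close> grows no faster than
  \<open>exp (n * htop X0)\<close>, so the pressure is \<open>htop X0\<close> from some \<open>\<beta>c\<close> on. As the integral of the potential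
  is negative unless the measure lives on \<open>X0\<close>, the equilibrium states beyond \<open>\<beta>c\<close> are exactly the
  measures of maximal entropy of \<open>X0\<close>, none of which is an equilibrium state below \<open>\<beta>c\<close>; they form a
  nonempty set, closed under vague limits by upper semicontinuity of entropy.\<close>

section \<open>Subadditive sequences and languages\<close>

text \<open>Language words are counted with two precisions. A complete block has dyadic length,
  where \<open>kappa\<close> records the count exactly; the hypothesis on \<open>a\<close> is set
  against these exact counts. The last block of a word without failure has arbitrary length, where
  only \<open>K * exp ((htop X + e) * n)\<close> is available. Such a word has about log n blocks,
  so the loss is K to that power: polynomial in n, hence invisible in the pressure. After a failure
  the parse resumes at the start of the failing block, because only the positions in front of it
  have been charged. Entropy is a supremum over all finite measurable partitions, so it must first
  be identified with the growth rate of block entropies. That rate is also an infimum over block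
  lengths, which gives both the bound through finite words and upper semicontinuity. A measure of
  maximal entropy has to be constructed: if \<open>MME X\<close> were empty, the sets of equilibrium
  states on both sides of the critical parameter could be empty and no transition would be
  visible.\<close>

lemma subadditive_bound:
  fixes f :: "nat \<Rightarrow> real"
  assumes "\<And>m n. f (m + n) \<le> f m + f n"
  shows "f (k * m + r) \<le> real k * f m + f r"
proof (induction k)
  case (Suc k)
  have "f (Suc k * m + r) = f (m + (k * m + r))" by (simp add: algebra_simps)
  also have "\<dots> \<le> f m + f (k * m + r)" by (rule assms)
  finally show ?case using Suc by (simp add: algebra_simps)
qed simp

text \<open>The limit is the infimum of the quotients. That it lies below each quotient is used as
  much as the convergence: it makes \<open>kappa\<close> nonnegative and bounds the entropy of a
  measure by its entropy on blocks of any fixed length.\<close>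

lemma Fekete:
  fixes f :: "nat \<Rightarrow> real"
  assumes sub: "\<And>m n. f (m + n) \<le> f m + f n" and nonneg: "\<And>n. 0 \<le> f n"
  obtains l where "(\<lambda>n. f n / real n) \<longlonglongrightarrow> l" "0 \<le> l" "\<And>n. n \<ge> 1 \<Longrightarrow> l \<le> f n / real n"
proof -
  define l where "l = (INF n\<in>{1..}. f n / real n)"
  have bdd: "bdd_below ((\<lambda>n. f n / real n) ` {1..})"
    by (rule bdd_belowI[of _ 0]) (auto simp: nonneg)
  have le: "l \<le> f n / real n" if "n \<ge> 1" for n
    unfolding l_def by (rule cINF_lower[OF bdd]) (use that in auto)
  have l0: "0 \<le> l"
    unfolding l_def by (rule cINF_greatest) (auto simp: nonneg)
  have "(\<lambda>n. f n / real n) \<longlonglongrightarrow> l"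
  proof (rule LIMSEQ_I)
    fix e :: real assume e: "0 < e"
    have "\<exists>n\<in>{1..}. f n / real n < l + e / 2"
      unfolding l_def by (subst cINF_less_iff[symmetric]) (use bdd e in \<open>auto simp: l_def[symmetric]\<close>)
    then obtain m where m: "m \<ge> 1" "f m / real m < l + e / 2" by auto
    \<comment> \<open>One constant for all remainders modulo \<open>m\<close>; divided by
      \<open>n\<close> it vanishes.\<close>
    define C where "C = (\<Sum>r<m. f r)"
    have C: "f r \<le> C" if "r < m" for r
      unfolding C_def by (rule member_le_sum) (use that nonneg in auto)
    obtain N where N: "real N > 2 * C / e" using reals_Archimedean2 by blast
    have C0: "C \<ge> 0" unfolding C_def by (auto intro: sum_nonneg nonneg)
    show "\<exists>N. \<forall>n\<ge>N. norm (f n / real n - l) < e"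
    proof (intro exI[of _ "max N 1"] allI impI)
      fix n assume n: "n \<ge> max N 1"
      then have n1: "n \<ge> 1" "real n > 2 * C / e" using N by auto
      have "f n = f ((n div m) * m + n mod m)" by simp
      also have "\<dots> \<le> real (n div m) * f m + f (n mod m)"
        by (rule subadditive_bound[OF sub])
      also have "\<dots> \<le> real (n div m) * f m + C"
        using C[of "n mod m"] m(1) by simp
      also have "real (n div m) * f m \<le> (real n / real m) * f m"
        by (intro mult_right_mono nonneg) (simp add: of_nat_div_le_of_nat)
      finally have "f n / real n \<le> f m / real m + C / real n"
        using n1 m by (simp add: field_simps)
      also have "C / real n < e / 2"
        using n1 e by (simp add: field_simps)
      finally have "f n / real n < l + e" using m(2) by linarith
      then show "norm (f n / real n - l) < e" using le[OF n1(1)] by simp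
    qed
  qed
  then show thesis using l0 le by (rule that)
qed

section \<open>Words, cylinders and the language of a subshift\<close>

definition prefix :: "nat \<Rightarrow> (nat \<Rightarrow> 'a) \<Rightarrow> 'a list" where
  "prefix n x = map x [0..<n]"

definition words :: "nat \<Rightarrow> 'a list set" where
  "words n = {w. length w = n}"

lemma length_prefix [simp]: "length (prefix n x) = n"
  by (simp add: prefix_def)

lemma nth_prefix [simp]: "i < n \<Longrightarrow> prefix n x ! i = x i"
  by (simp add: prefix_def)

lemma prefix_in_words [simp]: "prefix n x \<in> words n"
  by (simp add: words_def)

lemma finite_words [simp]: "finite (words n :: 'a::finite list set)"
  using finite_lists_length_eq[of "UNIV :: 'a set" n] by (simp add: words_def)

lemma card_words: "card (words n :: 'a::finite list set) = CARD('a) ^ n"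
  using card_lists_length_eq[of "UNIV :: 'a set" n] by (simp add: words_def)

lemma words_0 [simp]: "words 0 = {[]}"
  by (auto simp: words_def)

lemma shift_pow: "(shift ^^ k) x = (\<lambda>i. x (k + i))"
  by (induction k arbitrary: x) (auto simp: shift_def fun_eq_iff)

lemma shift_pow_nth [simp]: "(shift ^^ k) x i = x (k + i)"
  by (simp add: shift_pow)

lemma take_prefix: "m \<le> n \<Longrightarrow> take m (prefix n x) = prefix m x"
  by (rule nth_equalityI) auto

lemma drop_prefix: "drop k (prefix n x) = prefix (n - k) ((shift ^^ k) x)"
  by (rule nth_equalityI) auto

lemma prefix_add: "prefix (m + n) x = prefix m x @ prefix n ((shift ^^ m) x)"
  by (metis append_take_drop_id drop_prefix take_prefix le_add1 diff_add_inverse)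

lemma prefix_eq_iff: "prefix n x = prefix n y \<longleftrightarrow> (\<forall>i<n. x i = y i)"
  by (auto simp: prefix_def)

lemma prefix_surj: "w \<in> words n \<Longrightarrow> \<exists>x. prefix n x = w"
  by (rule exI[of _ "\<lambda>i. w ! i"]) (auto simp: words_def intro: nth_equalityI)

text \<open>Points whose first difference is at index n have distance exactly 2^-n. The strict
  inequality therefore excludes a difference at n itself, which is where the \<open>Suc\<close>
  comes from.\<close>

lemma sdist_less_iff: "sdist x y < (1/2) ^ n \<longleftrightarrow> prefix (Suc n) x = prefix (Suc n) y"
proof (cases "x = y")
  case False
  then obtain k where k: "x k \<noteq> y k" by auto
  define l where "l = (LEAST n. x n \<noteq> y n)"
  have l: "x l \<noteq> y l" "\<And>i. i < l \<Longrightarrow> x i = y i"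
    unfolding l_def using k by (metis (mono_tags, lifting) LeastI, meson not_less_Least)
  have "sdist x y = (1/2) ^ l" using False by (simp add: sdist_def l_def)
  then have "sdist x y < (1/2) ^ n \<longleftrightarrow> n < l"
    using power_strict_decreasing_iff[of "1/2 :: real" l n] by auto
  also have "\<dots> \<longleftrightarrow> prefix (Suc n) x = prefix (Suc n) y"
    unfolding prefix_eq_iff using l by (metis less_Suc_eq_le linorder_not_le order_less_le_trans)
  finally show ?thesis .
qed (simp add: sdist_def)

lemma scontinuous_prefix:
  assumes "\<And>x y. prefix n x = prefix n y \<Longrightarrow> f x = f y"
  shows "scontinuous f"
  unfolding scontinuous_def
proof (intro allI impI)
  fix x and e :: real assume e: "e > 0"
  show "\<exists>d>0. \<forall>y. sdist x y < d \<longrightarrow> \<bar>f y - f x\<bar> < e"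
  proof (intro exI[of _ "(1/2) ^ n"] conjI allI impI)
    fix y assume "sdist x y < (1/2) ^ n"
    then have "prefix n x = prefix n y" by (auto simp: sdist_less_iff prefix_eq_iff)
    then show "\<bar>f y - f x\<bar> < e" using assms[of x y] e by simp
  qed simp
qed

locale ssubshift =
  fixes X :: "(nat \<Rightarrow> 'a::finite) set"
  assumes subshift: "subshift X"
begin

lemma shift_pow_in: "x \<in> X \<Longrightarrow> (shift ^^ k) x \<in> X"
  using subshift by (induction k) (auto simp: subshift_def)

text \<open>Invariance under the shift moves an occurrence at any position to the front, so a word
  of the language can always be taken as a prefix.\<close>

lemma lang_eq: "lang m X = prefix m ` X"
proof
  show "lang m X \<subseteq> prefix m ` X"
  proof
    fix w assume "w \<in> lang m X"
    then obtain x k where "x \<in> X" "w = map (\<lambda>i. x (k + i)) [0..<m]" by (auto simp: lang_def)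
    then have "w = prefix m ((shift ^^ k) x)" by (simp add: prefix_def)
    then show "w \<in> prefix m ` X" using shift_pow_in[OF \<open>x \<in> X\<close>] by auto
  qed
  show "prefix m ` X \<subseteq> lang m X"
    unfolding lang_def prefix_def by (auto intro!: exI[of _ "0::nat"])
qed

lemma lang_subset_words: "lang m X \<subseteq> words m"
  by (auto simp: lang_eq)

lemma finite_lang [simp]: "finite (lang m X)"
  by (rule finite_subset[OF lang_subset_words]) simp

lemma lang_nonempty: "lang m X \<noteq> {}"
  using subshift by (auto simp: lang_eq subshift_def)

lemma card_lang_ge_1: "card (lang m X) \<ge> 1"
  using lang_nonempty by (simp add: Suc_leI card_gt_0_iff)

lemma card_lang_add: "card (lang (m + n) X) \<le> card (lang m X) * card (lang n X)"
proof -
  have "lang (m + n) X \<subseteq> (\<lambda>(u, v). u @ v) ` (lang m X \<times> lang n X)"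
    using shift_pow_in by (auto simp: lang_eq prefix_add)
  then have "card (lang (m + n) X) \<le> card ((\<lambda>(u, v). u @ v) ` (lang m X \<times> lang n X))"
    by (intro card_mono) auto
  also have "\<dots> \<le> card (lang m X \<times> lang n X)" by (rule card_image_le) simp
  finally show ?thesis by (simp add: card_cartesian_product)
qed

lemma ln_card_lang_nonneg: "0 \<le> ln (real (card (lang n X)))"
  using card_lang_ge_1[of n] by simp

lemma ln_card_lang_add:
  "ln (real (card (lang (m + n) X))) \<le> ln (real (card (lang m X))) + ln (real (card (lang n X)))"
proof -
  have "ln (real (card (lang (m + n) X))) \<le> ln (real (card (lang m X) * card (lang n X)))"
    using card_lang_add[of m n] card_lang_ge_1[of "m+n"] card_lang_ge_1[of m] card_lang_ge_1[of n]
    by (subst ln_le_cancel_iff) (simp_all del: of_nat_mult)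
  also have "\<dots> = ln (real (card (lang m X))) + ln (real (card (lang n X)))"
    using card_lang_ge_1[of m] card_lang_ge_1[of n] unfolding of_nat_mult
    by (intro ln_mult_pos) (simp_all add: less_eq_Suc_le)
  finally show ?thesis .
qed

lemma
  shows htop_lim: "(\<lambda>m. ln (real (card (lang m X))) / real m) \<longlonglongrightarrow> htop X"
    and htop_nonneg: "0 \<le> htop X"
    and htop_le: "n \<ge> 1 \<Longrightarrow> htop X \<le> ln (real (card (lang n X))) / real n"
proof -
  obtain l where l: "(\<lambda>m. ln (real (card (lang m X))) / real m) \<longlonglongrightarrow> l" "0 \<le> l"
    "\<And>n. n \<ge> 1 \<Longrightarrow> l \<le> ln (real (card (lang n X))) / real n"
    using Fekete[of "\<lambda>n. ln (real (card (lang n X)))", OF ln_card_lang_add ln_card_lang_nonneg] by blast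
  have "htop X = l" unfolding htop_def by (rule limI[OF l(1)])
  then show "(\<lambda>m. ln (real (card (lang m X))) / real m) \<longlonglongrightarrow> htop X" "0 \<le> htop X"
    "n \<ge> 1 \<Longrightarrow> htop X \<le> ln (real (card (lang n X))) / real n" using l by auto
qed

lemma kappa_nonneg: "0 \<le> kappa X i"
  using htop_le[of "2^i"] by (simp add: kappa_def)

text \<open>An identity, with no error term: \<open>kappa X i\<close> is by definition the excess of
  the exponential rate at length 2^i over its limit.\<close>

lemma card_lang_pow2: "real (card (lang (2 ^ i) X)) = exp (2 ^ i * htop X + 2 ^ i * kappa X i)"
  using card_lang_ge_1[of "2^i"] by (simp add: kappa_def right_diff_distrib)

text \<open>Beyond some length the slack \<open>e\<close> suffices with constant 1; \<open>K\<close>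
  absorbs the finitely many shorter lengths. At \<open>e = 0\<close> the count may exceed the
  exponential by an unbounded factor.\<close>

lemma card_lang_le_exp:
  assumes "e > 0"
  obtains K where "K \<ge> 1" "\<And>n. real (card (lang n X)) \<le> K * exp ((htop X + e) * real n)"
proof -
  have "\<forall>\<^sub>F n in sequentially. ln (real (card (lang n X))) / real n < htop X + e"
    by (rule order_tendstoD(2)[OF htop_lim]) (use assms in simp)
  then obtain N where N: "\<And>n. n \<ge> N \<Longrightarrow> ln (real (card (lang n X))) / real n < htop X + e"
    by (auto simp: eventually_sequentially)
  define K where "K = 1 + (\<Sum>n\<le>N. real (card (lang n X)))"
  have "real (card (lang n X)) \<le> K * exp ((htop X + e) * real n)" for n
  proof (cases "n \<le> N")
    case True
    have "real (card (lang n X)) \<le> (\<Sum>n\<le>N. real (card (lang n X)))"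
      by (rule member_le_sum) (use True in auto)
    also have "\<dots> \<le> K * 1" by (simp add: K_def)
    also have "\<dots> \<le> K * exp ((htop X + e) * real n)"
      using htop_nonneg assms by (intro mult_left_mono) (auto simp: K_def intro!: sum_nonneg add_nonneg_nonneg)
    finally show ?thesis .
  next
    case False
    then have "ln (real (card (lang n X))) < (htop X + e) * real n"
      using N[of n] by (simp add: field_simps)
    then have "real (card (lang n X)) \<le> 1 * exp ((htop X + e) * real n)"
      using card_lang_ge_1[of n] by (metis exp_ln exp_less_mono less_eq_real_def mult_1 of_nat_0_less_iff order_less_le_trans zero_less_one)
    also have "\<dots> \<le> K * exp ((htop X + e) * real n)"
      by (intro mult_right_mono) (auto simp: K_def intro!: sum_nonneg)
    finally show ?thesis .
  qed
  then show thesis by (rule that[rotated]) (auto simp: K_def intro!: sum_nonneg)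
qed

text \<open>This is where closedness enters: a point all of whose prefixes occur in X is
  approximated by points of X. It presents X as a countable intersection of clopen sets.\<close>

lemma in_iff_prefix: "x \<in> X \<longleftrightarrow> (\<forall>m. prefix m x \<in> lang m X)"
proof
  assume *: "\<forall>m. prefix m x \<in> lang m X"
  have "\<exists>y\<in>X. sdist x y < e" if "e > 0" for e
  proof -
    obtain n where n: "(1/2) ^ n < e" using real_arch_pow_inv[of e "1/2"] \<open>e > 0\<close> by auto
    obtain y where y: "y \<in> X" "prefix (Suc n) x = prefix (Suc n) y"
      using * by (force simp: lang_eq)
    then show ?thesis using n sdist_less_iff[of x y n] by force
  qed
  then show "x \<in> X" using subshift unfolding subshift_def sclosed_def by blast
qed (auto simp: lang_eq)

definition language :: "'a list set" where
  "language = (\<Union>m. lang m X)"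

lemma language_iff: "w \<in> language \<longleftrightarrow> w \<in> lang (length w) X"
  using lang_subset_words by (fastforce simp: language_def words_def)

lemma language_take: "w \<in> language \<Longrightarrow> take k w \<in> language"
proof -
  assume "w \<in> language"
  then obtain x where x: "x \<in> X" "w = prefix (length w) x" by (auto simp: language_iff lang_eq)
  have "take k w = prefix (min k (length w)) x"
    by (subst x(2)) (cases "k \<le> length w"; simp add: take_prefix min_def)
  then show ?thesis using x(1) by (auto simp: language_def lang_eq)
qed

lemma language_drop: "w \<in> language \<Longrightarrow> drop k w \<in> language"
proof -
  assume "w \<in> language"
  then obtain x where x: "x \<in> X" "w = prefix (length w) x" by (auto simp: language_iff lang_eq)
  have "drop k w = prefix (length w - k) ((shift ^^ k) x)"
    by (subst x(2)) (simp add: drop_prefix)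
  then show ?thesis using shift_pow_in[OF x(1), of k] by (auto simp: language_def lang_eq)
qed

lemma Nil_in_language [simp]: "[] \<in> language"
  using lang_nonempty[of 0] lang_subset_words[of 0] by (auto simp: language_def)

end

section \<open>Parsing words into dyadic blocks\<close>

text \<open>Blocks 0, ..., i-1 fill exactly the first 2^i - 1 positions. A block cut off by the end
  of the word is kept in truncated form, and blocks beyond the end are empty, hence in the
  language.\<close>

definition blk :: "nat \<Rightarrow> 'a list \<Rightarrow> 'a list" where
  "blk i w = take (2 ^ i) (drop (2 ^ i - 1) w)"

text \<open>A Birkhoff sum on words: passing to a suffix plays the part of the shift.\<close>

primrec suffix_sum :: "('a list \<Rightarrow> real) \<Rightarrow> 'a list \<Rightarrow> real" where
  "suffix_sum p [] = 0"
| "suffix_sum p (c # w) = p (c # w) + suffix_sum p w"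

lemma suffix_sum_ge:
  assumes "\<And>t. t < j \<Longrightarrow> c \<le> p (drop t w)" "j \<le> length w"
  shows "real j * c + suffix_sum p (drop j w) \<le> suffix_sum p w"
  using assms
proof (induction j arbitrary: w)
  case (Suc j)
  then obtain b v where w: "w = b # v" by (cases w) auto
  have "c \<le> p (drop t v)" if "t < j" for t
    using Suc.prems(1)[of "Suc t"] that by (simp add: w)
  then have "real j * c + suffix_sum p (drop j v) \<le> suffix_sum p v"
    using Suc.prems(2) by (intro Suc.IH) (auto simp: w)
  moreover have "c \<le> p w" using Suc.prems(1)[of 0] by simp
  ultimately show ?case by (simp add: w algebra_simps)
qed simp

lemma sum_UN_le:
  fixes f :: "'a \<Rightarrow> real"
  assumes "finite I" "\<And>i. i \<in> I \<Longrightarrow> finite (A i)" "\<And>x. 0 \<le> f x"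
  shows "sum f (\<Union>i\<in>I. A i) \<le> (\<Sum>i\<in>I. sum f (A i))"
  using assms
proof (induction I rule: finite_induct)
  case (insert i I)
  have "sum f (\<Union>i\<in>insert i I. A i) = sum f (A i) + sum f (\<Union>i\<in>I. A i) - sum f (A i \<inter> (\<Union>i\<in>I. A i))"
    unfolding UN_insert using insert.prems insert.hyps by (intro sum_Un) auto
  also have "\<dots> \<le> sum f (A i) + (\<Sum>i\<in>I. sum f (A i))"
    using insert.IH insert.prems sum_nonneg[of "A i \<inter> (\<Union>i\<in>I. A i)" f] by force
  finally show ?case using insert.hyps by simp
qed simp

lemma pow2_minus_1_ge_1:
  assumes "i \<ge> 1"
  shows "1 \<le> (2::nat) ^ i - 1"
proof -
  have "(2::nat) ^ 1 \<le> 2 ^ i" by (rule power_increasing) (use assms in auto)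
  then show ?thesis by simp
qed

lemma blk_take: "k < i \<Longrightarrow> blk k (take (2 ^ i - 1) w) = blk k w"
proof -
  assume "k < i"
  then have "(2::nat) ^ Suc k \<le> 2 ^ i" by (intro power_increasing) auto
  then have "(2::nat) ^ k \<le> 2 ^ i - 1 - (2 ^ k - 1)" by auto
  then show ?thesis by (simp add: blk_def drop_take min_absorb1)
qed

context ssubshift
begin

text \<open>What a point starting with \<open>u\<close> is certain to pay. A word of the language
  guarantees nothing, since the point may stay in \<open>X\<close>; otherwise the word itself
  reveals the exit time.\<close>

definition pen :: "(nat \<Rightarrow> real) \<Rightarrow> 'a list \<Rightarrow> real" where
  "pen a u = (if u \<in> language then 0 else a (LEAST j. take (Suc j) u \<notin> language))"

lemma pen_ge:
  assumes "decseq a" "take (Suc m) u \<notin> language"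
  shows "a m \<le> pen a u"
proof -
  have "u \<notin> language" using assms(2) language_take by auto
  moreover have "(LEAST j. take (Suc j) u \<notin> language) \<le> m" using assms(2) by (rule Least_le)
  ultimately show ?thesis using assms(1) by (simp add: pen_def decseq_def)
qed

definition good :: "nat \<Rightarrow> nat \<Rightarrow> 'a list set" where
  "good i n = {w \<in> words n. \<forall>k<i. blk k w \<in> language}"

definition fail :: "nat \<Rightarrow> nat \<Rightarrow> 'a list set" where
  "fail i n = {w \<in> words n. blk i w \<notin> language \<and> (\<forall>k<i. blk k w \<in> language)}"

lemma finite_good [simp]: "finite (good i n)" and finite_fail [simp]: "finite (fail i n)"
  by (auto simp: good_def fail_def)

text \<open>The bounds on \<open>n\<close> say that the word ends within block \<open>i\<close>, or
  exactly at its end, so block \<open>i\<close> is the whole remainder after the first 2^i - 1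
  letters. Both counting lemmas below use it, for complete and for truncated last blocks.\<close>

lemma good_Suc:
  assumes "2 ^ i - 1 \<le> n" "n \<le> 2 ^ Suc i - 1"
  shows "card (good (Suc i) n) \<le> card (good i (2 ^ i - 1)) * card (lang (n - (2 ^ i - 1)) X)"
proof -
  have "good (Suc i) n \<subseteq> (\<lambda>(u, v). u @ v) ` (good i (2 ^ i - 1) \<times> lang (n - (2 ^ i - 1)) X)"
  proof
    fix w assume w: "w \<in> good (Suc i) n"
    then have len: "length w = n" by (simp add: good_def words_def)
    have "blk i w = drop (2 ^ i - 1) w"
    proof -
      have "(1::nat) \<le> 2 ^ i" by simp
      then have "n - (2 ^ i - 1) \<le> 2 ^ i" using assms(2) unfolding power_Suc by linarith
      then show ?thesis unfolding blk_def using len by (simp del: One_nat_def)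
    qed
    then have "drop (2 ^ i - 1) w \<in> language" using w by (auto simp: good_def)
    then have "drop (2 ^ i - 1) w \<in> lang (n - (2 ^ i - 1)) X"
      using len by (simp add: language_iff)
    moreover have "take (2 ^ i - 1) w \<in> good i (2 ^ i - 1)"
      using w len assms by (auto simp: good_def blk_take[unfolded One_nat_def] words_def)
    ultimately show "w \<in> (\<lambda>(u, v). u @ v) ` (good i (2 ^ i - 1) \<times> lang (n - (2 ^ i - 1)) X)"
      by (intro image_eqI[of _ _ "(take (2 ^ i - 1) w, drop (2 ^ i - 1) w)"]) auto
  qed
  then have "card (good (Suc i) n) \<le> card ((\<lambda>(u, v). u @ v) ` (good i (2 ^ i - 1) \<times> lang (n - (2 ^ i - 1)) X))"
    by (intro card_mono) auto
  also have "\<dots> \<le> card (good i (2 ^ i - 1) \<times> lang (n - (2 ^ i - 1)) X)"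
    by (rule card_image_le) simp
  finally show ?thesis by (simp add: card_cartesian_product)
qed

lemma card_good_0: "card (good 0 0) = 1"
  by (simp add: good_def)

text \<open>All blocks are complete, so the count is at most a product of the exact dyadic counts,
  and their excesses add up to the sum in the hypothesis on \<open>a\<close>.\<close>

lemma card_good_full:
  "real (card (good i (2 ^ i - 1))) \<le> exp (htop X * real (2 ^ i - 1) + (\<Sum>k<i. 2 ^ k * kappa X k))"
proof (induction i)
  case (Suc i)
  have "(2::nat) ^ Suc i - 1 - (2 ^ i - 1) = 2 ^ i" by simp
  then have "real (card (good (Suc i) (2 ^ Suc i - 1))) \<le> real (card (good i (2 ^ i - 1)) * card (lang (2 ^ i) X))"
    using good_Suc[of i "2 ^ Suc i - 1"] by (metis diff_le_mono le_refl of_nat_mono one_le_numeral power_increasing le_SucI)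
  also have "\<dots> \<le> exp (htop X * real (2 ^ i - 1) + (\<Sum>k<i. 2 ^ k * kappa X k)) * exp (2 ^ i * htop X + 2 ^ i * kappa X i)"
    unfolding of_nat_mult card_lang_pow2 by (intro mult_right_mono Suc.IH) simp
  also have "\<dots> = exp (htop X * real (2 ^ Suc i - 1) + (\<Sum>k<Suc i. 2 ^ k * kappa X k))"
    by (simp add: exp_add[symmetric] of_nat_diff algebra_simps)
  finally show ?case .
qed (simp add: card_good_0)

text \<open>For a truncated block \<open>kappa\<close> says nothing, so each block is charged the
  constant \<open>K\<close>. This is affordable because a word of length n needs only
  logarithmically many blocks.\<close>

lemma card_good_le:
  assumes K: "K \<ge> 1" "\<And>n. real (card (lang n X)) \<le> K * exp (h * real n)"
    and n: "n \<le> 2 ^ i - 1"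
  shows "real (card (good i n)) \<le> K ^ i * exp (h * real n)"
  using n
proof (induction i arbitrary: n)
  case (Suc i)
  show ?case
  proof (cases "n \<le> 2 ^ i - 1")
    case True
    have "card (good (Suc i) n) \<le> card (good i n)"
      by (intro card_mono) (auto simp: good_def)
    then have "real (card (good (Suc i) n)) \<le> K ^ i * exp (h * real n)"
      using Suc.IH[OF True] by linarith
    also have "\<dots> \<le> K ^ Suc i * exp (h * real n)"
      using K(1) by (intro mult_right_mono power_increasing) auto
    finally show ?thesis .
  next
    case False
    then have n: "2 ^ i - 1 \<le> n" by simp
    have "real (card (good (Suc i) n)) \<le> real (card (good i (2 ^ i - 1)) * card (lang (n - (2 ^ i - 1)) X))"
      using good_Suc[OF n Suc.prems] by (simp only: of_nat_le_iff)
    also have "\<dots> \<le> (K ^ i * exp (h * real (2 ^ i - 1))) * (K * exp (h * real (n - (2 ^ i - 1))))"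
      unfolding of_nat_mult using K by (intro mult_mono Suc.IH) auto
    also have "\<dots> = K ^ Suc i * (exp (h * real (2 ^ i - 1)) * exp (h * real (n - (2 ^ i - 1))))"
      by simp
    also have "exp (h * real (2 ^ i - 1)) * exp (h * real (n - (2 ^ i - 1))) = exp (h * real n)"
      using n by (simp add: exp_add[symmetric] of_nat_diff algebra_simps del: of_nat_power)
    finally show ?thesis .
  qed
qed (simp add: card_good_0)

text \<open>Either no block fails, and then \<open>m\<close> may be chosen at will, or there is a
  first failing block. That block is nonempty, which bounds its index by the length. Index 0 stays
  separate because no letters precede block 0.\<close>

lemma words_subset: "words n \<subseteq> good m n \<union> fail 0 n \<union> (\<Union>i\<in>{1..n}. fail i n)"
proof
  fix w :: "'a list" assume w: "w \<in> words n"
  show "w \<in> good m n \<union> fail 0 n \<union> (\<Union>i\<in>{1..n}. fail i n)"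
  proof (cases "\<forall>i. blk i w \<in> language")
    case True
    then show ?thesis using w by (auto simp: good_def)
  next
    case False
    define i where "i = (LEAST i. blk i w \<notin> language)"
    have i: "blk i w \<notin> language" "\<And>k. k < i \<Longrightarrow> blk k w \<in> language"
      unfolding i_def using False by (metis (mono_tags, lifting) LeastI, meson not_less_Least)
    have "blk i w \<noteq> []" using i(1) by auto
    then have "2 ^ i - 1 < length w" by (auto simp: blk_def)
    moreover have "i < 2 ^ i" by simp
    ultimately have "i \<le> n" using w unfolding words_def mem_Collect_eq by linarith
    then show ?thesis using i w by (cases "i = 0") (auto simp: fail_def)
  qed
qed

text \<open>A failing block ending before position \<open>2 j + 1\<close> makes every suffix starting in the first
  \<open>j\<close> positions leave the language after at most \<open>2 j\<close> further letters.\<close>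

lemma fail_cost:
  assumes a: "decseq a" and i: "i \<ge> 1" and w: "w \<in> fail i n" and j: "j = 2 ^ i - 1"
  shows "j \<le> n" "real j * a (3 * j) + suffix_sum (pen a) (drop j w) \<le> suffix_sum (pen a) w"
proof -
  have bad: "blk i w \<notin> language" and len: "length w = n" using w by (auto simp: fail_def words_def)
  have "blk i w \<noteq> []" using bad by auto
  then show jn: "j \<le> n" using len by (auto simp: blk_def j)
  have "a (3 * j) \<le> pen a (drop t w)" if t: "t < j" for t
  proof -
    have p: "(2::nat) ^ i \<ge> 1" by simp
    have e1: "Suc (2 * j - t) - (j - t) = 2 ^ i" using t p unfolding j by linarith
    have e2: "drop (j - t) (take (Suc (2 * j - t)) (drop t w)) = blk i w"
      unfolding drop_take e1 using t by (simp add: blk_def j)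
    have "take (Suc (2 * j - t)) (drop t w) \<notin> language"
      using language_drop[of "take (Suc (2 * j - t)) (drop t w)" "j - t"] bad e2 by auto
    from pen_ge[OF a this] have "a (2 * j - t) \<le> pen a (drop t w)" .
    moreover have "a (3 * j) \<le> a (2 * j - t)" using a by (auto simp: decseq_def)
    ultimately show ?thesis by linarith
  qed
  then show "real j * a (3 * j) + suffix_sum (pen a) (drop j w) \<le> suffix_sum (pen a) w"
    using jn len by (intro suffix_sum_ge) auto
qed

definition Z :: "(nat \<Rightarrow> real) \<Rightarrow> real \<Rightarrow> nat \<Rightarrow> real" where
  "Z a b n = (\<Sum>w\<in>words n. exp (- b * suffix_sum (pen a) w))"

lemma Z_nonneg: "0 \<le> Z a b n"
  by (auto simp: Z_def intro: sum_nonneg)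

text \<open>Cutting in front of the failing block is injective. The front part is a good word of
  length \<open>j\<close> that has paid its toll; of the rest, which still begins with the failing
  block, only its length is remembered.\<close>

lemma sum_fail:
  assumes a: "decseq a" and i: "i \<ge> 1" and j: "j = 2 ^ i - 1" and jn: "j \<le> n" and b: "b \<ge> 0"
  shows "(\<Sum>w\<in>fail i n. exp (- b * suffix_sum (pen a) w))
           \<le> real (card (good i j)) * exp (- b * (real j * a (3 * j))) * Z a b (n - j)"
proof -
  let ?g = "\<lambda>(u, v). exp (- b * (real j * a (3 * j))) * exp (- b * suffix_sum (pen a) v)"
  let ?s = "\<lambda>w. (take j w, drop j w)"
  have "(\<Sum>w\<in>fail i n. exp (- b * suffix_sum (pen a) w)) \<le> (\<Sum>w\<in>fail i n. ?g (?s w))"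
  proof (rule sum_mono)
    fix w assume w: "w \<in> fail i n"
    have "b * (real j * a (3 * j) + suffix_sum (pen a) (drop j w)) \<le> b * suffix_sum (pen a) w"
      by (intro mult_left_mono fail_cost(2)[OF a i w j] b)
    then show "exp (- b * suffix_sum (pen a) w) \<le> ?g (?s w)"
      by (simp add: exp_add[symmetric] algebra_simps)
  qed
  also have "\<dots> = (\<Sum>p\<in>?s ` fail i n. ?g p)"
    by (subst sum.reindex) (rule inj_onI, metis append_take_drop_id prod.inject, simp)
  also have "\<dots> \<le> (\<Sum>p\<in>good i j \<times> words (n - j). ?g p)"
  proof (rule sum_mono2)
    show "?s ` fail i n \<subseteq> good i j \<times> words (n - j)"
      using jn by (auto simp: fail_def good_def words_def j blk_take[unfolded One_nat_def])
  qed auto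
  also have "\<dots> = real (card (good i j)) * exp (- b * (real j * a (3 * j))) * Z a b (n - j)"
    by (simp add: sum.cartesian_product[symmetric] sum_distrib_left Z_def mult.assoc del: mult_minus_left)
  finally show ?thesis .
qed

text \<open>Cutting in front of block 0 would leave the word as long as before. Instead its first
  letter is removed: it lies outside the language, so the whole word pays \<open>a 0\<close> at its
  first position.\<close>

lemma sum_fail_0:
  assumes a: "decseq a" and b: "b \<ge> 0" and n: "n \<ge> 1"
  shows "(\<Sum>w\<in>fail 0 n. exp (- b * suffix_sum (pen a) w))
           \<le> real CARD('a) * exp (- b * a 0) * Z a b (n - 1)"
proof -
  let ?g = "\<lambda>(c :: 'a, v). exp (- b * a 0) * exp (- b * suffix_sum (pen a) v)"
  let ?s = "\<lambda>w. (hd w, tl w)"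
  have ne: "w \<noteq> []" if "w \<in> fail 0 n" for w using that n by (auto simp: fail_def words_def)
  have "(\<Sum>w\<in>fail 0 n. exp (- b * suffix_sum (pen a) w)) \<le> (\<Sum>w\<in>fail 0 n. ?g (?s w))"
  proof (rule sum_mono)
    fix w assume w: "w \<in> fail 0 n"
    then have "take (Suc 0) w \<notin> language" by (auto simp: fail_def blk_def)
    from pen_ge[OF a this] have "a 0 \<le> pen a w" .
    then have "a 0 + suffix_sum (pen a) (tl w) \<le> suffix_sum (pen a) w"
      using ne[OF w] by (cases w) auto
    then have "b * (a 0 + suffix_sum (pen a) (tl w)) \<le> b * suffix_sum (pen a) w"
      by (intro mult_left_mono b)
    then show "exp (- b * suffix_sum (pen a) w) \<le> ?g (?s w)"
      by (simp add: exp_add[symmetric] algebra_simps)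
  qed
  also have "\<dots> = (\<Sum>p\<in>?s ` fail 0 n. ?g p)"
    by (subst sum.reindex) (rule inj_onI, metis list.expand prod.inject ne, simp)
  also have "\<dots> \<le> (\<Sum>p\<in>UNIV \<times> words (n - 1). ?g p)"
  proof (rule sum_mono2)
    show "finite ((UNIV :: 'a set) \<times> (words (n - 1) :: 'a list set))"
      by (intro finite_cartesian_product finite_words) simp
  qed (auto simp: fail_def words_def)
  also have "\<dots> = real CARD('a) * exp (- b * a 0) * Z a b (n - 1)"
    by (simp add: sum.cartesian_product[symmetric] sum_distrib_left Z_def mult.assoc del: mult_minus_left)
  finally show ?thesis .
qed

text \<open>A renewal inequality for the partition function, sorted by the first failing block.
  Words without failure are counted with weight at most 1.\<close>

lemma Z_recursion:
  assumes a: "decseq a" and b: "b \<ge> 0" and n: "n \<ge> 1"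
    and pen_nonneg: "\<And>w. 0 \<le> pen a w"
  shows "Z a b n \<le> real (card (good m n)) + real CARD('a) * exp (- b * a 0) * Z a b (n - 1)
    + (\<Sum>i\<in>{i\<in>{1..n}. 2 ^ i - 1 \<le> n}. real (card (good i (2 ^ i - 1)))
         * exp (- b * (real (2 ^ i - 1) * a (3 * (2 ^ i - 1)))) * Z a b (n - (2 ^ i - 1)))"
proof -
  let ?f = "\<lambda>w. exp (- b * suffix_sum (pen a) w)"
  let ?I = "{i\<in>{1..n}. 2 ^ i - 1 \<le> n}"
  have sn: "0 \<le> suffix_sum (pen a) w" for w by (induction w) (auto simp: pen_nonneg)
  \<comment> \<open>A failing block starts inside the word, so the part in front of it cannot be
    longer than the word.\<close>
  have emp: "fail i n = {}" if "i \<in> {1..n} - ?I" for i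
    using fail_cost(1)[OF a, of i _ n "2 ^ i - 1"] that by auto
  have eq: "(\<Union>i\<in>{1..n}. fail i n) = (\<Union>i\<in>?I. fail i n)" using emp by blast
  have "Z a b n \<le> sum ?f (good m n \<union> fail 0 n \<union> (\<Union>i\<in>?I. fail i n))"
    unfolding Z_def eq[symmetric] by (intro sum_mono2 words_subset) auto
  also have "\<dots> \<le> sum ?f (good m n \<union> fail 0 n) + sum ?f (\<Union>i\<in>?I. fail i n)"
    by (subst sum_Un) (auto intro!: sum_nonneg)
  also have "sum ?f (good m n \<union> fail 0 n) \<le> sum ?f (good m n) + sum ?f (fail 0 n)"
    by (subst sum_Un) (auto intro!: sum_nonneg)
  also have "sum ?f (\<Union>i\<in>?I. fail i n) \<le> (\<Sum>i\<in>?I. sum ?f (fail i n))"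
    by (rule sum_UN_le) auto
  also have "sum ?f (good m n) \<le> (\<Sum>w\<in>good m n. 1)"
    using sn b by (intro sum_mono) auto
  also have "(\<Sum>w\<in>good m n. 1) = real (card (good m n))" by simp
  also note sum_fail_0[OF a b n]
  also have "(\<Sum>i\<in>?I. sum ?f (fail i n)) \<le> (\<Sum>i\<in>?I. real (card (good i (2 ^ i - 1)))
         * exp (- b * (real (2 ^ i - 1) * a (3 * (2 ^ i - 1)))) * Z a b (n - (2 ^ i - 1)))"
    by (intro sum_mono sum_fail[OF a _ refl _ b]) auto
  finally show ?thesis by simp
qed

end

text \<open>At \<open>j = 2 ^ i - 1\<close> the sum in the hypothesis then runs over the indices 0,
  ..., i-1, which are exactly those of the blocks filling \<open>j\<close> letters.\<close>

lemma log2_pow2_minus1: "i \<ge> 1 \<Longrightarrow> nat \<lfloor>log 2 (real (2 ^ i - 1))\<rfloor> = i - 1"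
proof -
  assume "i \<ge> 1"
  then obtain k where i: "i = Suc k" by (cases i) auto
  have "(1::nat) \<le> 2 ^ k" by simp
  then have "real (2 ^ k) \<le> real (2 ^ i - 1)" unfolding of_nat_le_iff i by simp
  moreover have "real (2 ^ i - 1) < 2 ^ Suc k" by (simp add: i of_nat_diff)
  ultimately have "\<lfloor>log 2 (real (2 ^ i - 1))\<rfloor> = int k"
    by (intro floor_unique) (auto simp: le_log_iff log_less_iff powr_realpow powr_add)
  then show ?thesis by (simp add: i)
qed

section \<open>The partition function under the hypothesis on the potential\<close>

locale freezing = ssubshift +
  fixes a :: "nat \<Rightarrow> real"
  assumes dec: "decseq a"
    and ge: "\<And>j. j \<ge> 1 \<Longrightarrow> a (3 * j) \<ge> 2 * ln (real j) / real j
           + (1 / real j) * (\<Sum>i = 0..nat \<lfloor>log 2 (real j)\<rfloor>. 2 ^ i * kappa X i)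
           + 1 / real j"
begin

text \<open>The hypothesis makes \<open>a\<close> positive at positive multiples of 3, and there is
  such a multiple beyond every index, so monotonicity carries positivity down to all
  indices.\<close>

lemma a_pos: "0 < a n"
proof -
  have "0 < a (3 * Suc n)"
    by (rule order_less_le_trans[OF _ ge]) (auto intro!: add_nonneg_pos add_nonneg_nonneg divide_nonneg_nonneg sum_nonneg mult_nonneg_nonneg kappa_nonneg)
  also have "\<dots> \<le> a n" using dec by (auto simp: decseq_def)
  finally show ?thesis .
qed

text \<open>At \<open>j = 1\<close> the logarithm vanishes and the last term of the hypothesis is 1.
  Hence a bad first letter costs at least a factor \<open>exp (- b0)\<close>, like every other
  failure.\<close>

lemma a0_ge_1: "1 \<le> a 0"
proof -
  have "1 \<le> a 3" using ge[of 1] kappa_nonneg[of 0] by simp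
  also have "\<dots> \<le> a 0" using dec by (auto simp: decseq_def)
  finally show ?thesis .
qed

lemma pen_nonneg: "0 \<le> pen a w"
  using a_pos by (auto simp: pen_def less_imp_le)

lemma toll_ge:
  assumes "i \<ge> 1" and j: "j = 2 ^ i - 1"
  shows "2 * ln (real j) + (\<Sum>k<i. 2 ^ k * kappa X k) + 1 \<le> real j * a (3 * j)"
proof -
  have j1: "j \<ge> 1" using pow2_minus_1_ge_1[OF assms(1)] j by simp
  have "{0..nat \<lfloor>log 2 (real j)\<rfloor>} = {..<i}"
    unfolding j log2_pow2_minus1[OF \<open>i \<ge> 1\<close>] using \<open>i \<ge> 1\<close> by auto
  then show ?thesis using ge[OF j1] j1 by (simp add: field_simps)
qed

text \<open>Chosen so that the induction for \<open>Z\<close> closes with constant 2: all failures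
  together weigh \<open>exp (- b0) * (CARD('a) + 2)\<close> times twice the bound, where
  \<open>CARD('a)\<close> stems from bad first letters and 2 from a geometric series over the later
  blocks.\<close>

definition b0 :: real where "b0 = ln (2 * (real CARD('a) + 2))"

lemma b0_ge_1: "1 \<le> b0"
proof -
  have "exp 1 \<le> (3::real)" by (rule exp_le)
  also have "3 \<le> 2 * (real CARD('a) + 2)" by simp
  finally show ?thesis by (simp add: b0_def ln_ge_iff)
qed

text \<open>Each term of the hypothesis has its task: the \<open>kappa\<close> sum cancels the
  excess in the number of good words, the logarithm leaves 1/j and so a geometric weight in the
  block index, and the final 1 leaves the factor \<open>exp (- b0)\<close>. As \<open>b0\<close> is
  at least 1, multiplication by it preserves the first two.\<close>

lemma good_weight:
  assumes i: "i \<ge> 1" and j: "j = 2 ^ i - 1"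
  shows "real (card (good i j)) * exp (- b0 * (real j * a (3 * j))) \<le> exp (- b0) * (1/2) ^ (i - 1) * exp (htop X * real j)"
proof -
  let ?G = "\<Sum>k<i. 2 ^ k * kappa X k"
  have G: "0 \<le> ?G" by (intro sum_nonneg mult_nonneg_nonneg kappa_nonneg) simp
  have "(2::nat) ^ (i - 1) \<le> j" using i by (cases i) (auto simp: j Suc_leI)
  then have j2: "(2::real) ^ (i - 1) \<le> real j" by (metis of_nat_le_iff of_nat_numeral of_nat_power)
  have jpos: "0 < real j" by (rule order_less_le_trans[OF _ j2]) simp
  have "(1::real) \<le> 2 ^ (i - 1)" by simp
  then have "1 \<le> real j" using j2 by linarith
  then have lnj: "0 \<le> ln (real j)" by (rule ln_ge_zero)
  have "?G + ln (real j) + b0 \<le> b0 * (2 * ln (real j) + ?G + 1)"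
  proof -
    have "1 * ?G \<le> b0 * ?G" "1 * ln (real j) \<le> b0 * ln (real j)" "0 \<le> b0 * ln (real j)"
      using b0_ge_1 G lnj by (blast intro: mult_right_mono, blast intro: mult_right_mono, simp)
    then show ?thesis by (simp add: algebra_simps)
  qed
  also have "\<dots> \<le> b0 * (real j * a (3 * j))"
    using toll_ge[OF i j] b0_ge_1 by (intro mult_left_mono) auto
  finally have *: "?G + - b0 * (real j * a (3 * j)) \<le> - b0 - ln (real j)" by simp
  have "real (card (good i j)) * exp (- b0 * (real j * a (3 * j)))
      \<le> exp (htop X * real j + ?G) * exp (- b0 * (real j * a (3 * j)))"
    unfolding j by (intro mult_right_mono card_good_full) simp
  also have "\<dots> = exp (htop X * real j) * exp (?G + - b0 * (real j * a (3 * j)))"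
    by (simp add: exp_add[symmetric] algebra_simps)
  also have "\<dots> \<le> exp (htop X * real j) * exp (- b0 - ln (real j))"
    using * by (intro mult_left_mono) auto
  also have "exp (- b0 - ln (real j)) = exp (- b0) * (1 / real j)"
    using jpos by (simp add: exp_diff)
  also have "1 / real j \<le> (1/2) ^ (i - 1)"
    using j2 jpos by (simp add: power_divide frac_le)
  finally show ?thesis by (simp add: mult_ac)
qed

text \<open>Strong induction through the renewal inequality. The subexponential factor increases
  with the length, so the one for \<open>n\<close> may replace those of the shorter words, and the
  exponentials of the two parts of a cut word multiply to that of the whole.\<close>

lemma Z_le:
  assumes K: "K \<ge> 1" "\<And>n. real (card (lang n X)) \<le> K * exp (h * real n)" and h: "htop X \<le> h"
  shows "Z a b0 n \<le> 2 * K powr (log 2 (real n + 1) + 1) * exp (h * real n)"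
proof (induction n rule: less_induct)
  case (less n)
  define D where "D n = K powr (log 2 (real n + 1) + 1)" for n :: nat
  have h0: "0 \<le> h" using htop_nonneg h by linarith
  have D1: "1 \<le> D n" for n using K(1) by (simp add: D_def ge_one_powr_ge_zero)
  have D_mono: "D m \<le> D n" if "m \<le> n" for m n
    unfolding D_def using that K(1) by (intro powr_mono) auto
  note IH = less[folded D_def]
  let ?E = "D n * exp (h * real n)"
  have E0: "0 \<le> ?E" using D1[of n] by simp
  have "Z a b0 n \<le> 2 * ?E"
  proof (cases "n = 0")
    case True
    then show ?thesis using D1[of 0] by (simp add: Z_def)
  next
    case False
    then have n: "n \<ge> 1" by simp
    \<comment> \<open>Enough dyadic blocks to cover \<open>n\<close> letters, and at most one more
      than log2 (n+1), so that \<open>K ^ m\<close> stays below \<open>D n\<close>.\<close>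
    define m where "m = nat \<lceil>log 2 (real n + 1)\<rceil>"
    have l0: "0 \<le> log 2 (real n + 1)" by simp
    have "log 2 (real n + 1) \<le> real m" unfolding m_def by linarith
    then have "real n + 1 \<le> 2 ^ m" by (simp add: log_le_iff powr_realpow)
    then have "real (n + 1) \<le> real (2 ^ m)" by simp
    then have nm: "n \<le> 2 ^ m - 1" unfolding of_nat_le_iff by simp
    have "real m \<le> log 2 (real n + 1) + 1" unfolding m_def using l0 by linarith
    then have "K ^ m \<le> D n" unfolding D_def using K(1) by (subst powr_realpow[symmetric]) (auto intro!: powr_mono)
    then have good_m: "real (card (good m n)) \<le> ?E"
      using card_good_le[OF K nm] by (meson exp_ge_zero mult_right_mono order_trans)
    have c1: "real CARD('a) * exp (- b0 * a 0) * Z a b0 (n - 1) \<le> real CARD('a) * exp (- b0) * (2 * ?E)"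
    proof (intro mult_mono)
      have "b0 * 1 \<le> b0 * a 0" using a0_ge_1 b0_ge_1 by (intro mult_left_mono) auto
      then show "exp (- b0 * a 0) \<le> exp (- b0)" by simp
      have "Z a b0 (n - 1) \<le> 2 * D (n - 1) * exp (h * real (n - 1))" using n by (intro IH) auto
      also have "\<dots> \<le> 2 * D n * exp (h * real n)"
        using h0 D1[of n] D1[of "n - 1"] by (intro mult_mono D_mono) (auto intro: mult_left_mono)
      finally show "Z a b0 (n - 1) \<le> 2 * ?E" by (simp add: mult_ac)
    qed (auto simp: Z_nonneg)
    let ?I = "{i\<in>{1..n}. 2 ^ i - 1 \<le> n}"
    have c2: "real (card (good i (2 ^ i - 1))) * exp (- b0 * (real (2 ^ i - 1) * a (3 * (2 ^ i - 1)))) * Z a b0 (n - (2 ^ i - 1))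
        \<le> exp (- b0) * (1/2) ^ (i - 1) * (2 * ?E)" if i: "i \<in> ?I" for i
    proof -
      define j :: nat where "j = 2 ^ i - 1"
      have i1: "i \<ge> 1" and jn: "j \<le> n" using i by (auto simp: j_def)
      have j1: "1 \<le> j" using pow2_minus_1_ge_1[OF i1] by (simp add: j_def)
      have "real (card (good i j)) * exp (- b0 * (real j * a (3 * j))) * Z a b0 (n - j)
        \<le> (exp (- b0) * (1/2) ^ (i - 1) * exp (htop X * real j)) * (2 * D (n - j) * exp (h * real (n - j)))"
        using j1 jn D1[of "n - j"] by (intro mult_mono good_weight[OF i1 j_def] IH Z_nonneg) auto
      also have "\<dots> \<le> (exp (- b0) * (1/2) ^ (i - 1) * exp (h * real j)) * (2 * D n * exp (h * real (n - j)))"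
        using h D1[of n] D1[of "n - j"] by (intro mult_mono D_mono) (auto intro!: mult_right_mono)
      also have "\<dots> = exp (- b0) * (1/2) ^ (i - 1) * (2 * D n * (exp (h * real j) * exp (h * real (n - j))))"
        by simp
      also have "exp (h * real j) * exp (h * real (n - j)) = exp (h * real n)"
        using jn by (simp add: exp_add[symmetric] of_nat_diff algebra_simps)
      finally show ?thesis by (simp add: j_def mult.assoc)
    qed
    have geo: "(\<Sum>i\<in>?I. (1/2::real) ^ (i - 1)) \<le> 2"
    proof -
      have "(\<Sum>i\<in>?I. (1/2::real) ^ (i - 1)) \<le> (\<Sum>i\<in>{1..n}. (1/2::real) ^ (i - 1))"
        by (rule sum_mono2) auto
      also have "\<dots> = (\<Sum>i<n. (1/2::real) ^ i)"
        by (rule sum.reindex_bij_witness[of _ Suc "\<lambda>i. i - 1"]) auto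
      also have "\<dots> \<le> 2" by (simp add: geometric_sum)
      finally show ?thesis .
    qed
    have "Z a b0 n \<le> ?E + real CARD('a) * exp (- b0) * (2 * ?E) + (\<Sum>i\<in>?I. exp (- b0) * (1/2) ^ (i - 1) * (2 * ?E))"
      using b0_ge_1
      by (intro order_trans[OF Z_recursion[OF dec _ n pen_nonneg, of b0 m]] add_mono good_m c1 sum_mono c2) auto
    also have "(\<Sum>i\<in>?I. exp (- b0) * (1/2) ^ (i - 1) * (2 * ?E)) = (\<Sum>i\<in>?I. (1/2) ^ (i - 1)) * (exp (- b0) * (2 * ?E))"
      unfolding sum_distrib_right by (intro sum.cong) auto
    also have "\<dots> \<le> 2 * (exp (- b0) * (2 * ?E))"
      using E0 by (intro mult_right_mono geo) auto
    also have "?E + real CARD('a) * exp (- b0) * (2 * ?E) + 2 * (exp (- b0) * (2 * ?E))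
        = ?E * (1 + exp (- b0) * (2 * (real CARD('a) + 2)))"
      by (simp add: algebra_simps)
    \<comment> \<open>The failures contribute exactly one further copy of the bound for good
      words.\<close>
    also have "exp (- b0) * (2 * (real CARD('a) + 2)) = 1"
      by (simp add: b0_def exp_minus)
    finally show ?thesis by (simp add: mult_ac)
  qed
  then show ?case by (simp add: D_def mult_ac)
qed

end

section \<open>Entropy of shift-invariant measures\<close>

definition eta :: "real \<Rightarrow> real" where "eta p = - (p * ln p)"

lemma eta_0 [simp]: "eta 0 = 0" and eta_1 [simp]: "eta 1 = 0"
  by (simp_all add: eta_def)

lemma eta_nonneg: "0 \<le> p \<Longrightarrow> p \<le> 1 \<Longrightarrow> 0 \<le> eta p"
  by (cases "p = 0") (auto simp: eta_def mult_le_0_iff)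

text \<open>Both ends of the unit interval matter: an error variable that is nearly always trivial
  has one value of probability close to 1 and all others close to 0.\<close>

lemma eta_small:
  assumes "e > 0"
  obtains d where "d > 0" "\<And>p. 0 \<le> p \<Longrightarrow> p \<le> d \<Longrightarrow> eta p \<le> e" "\<And>p. 1 - d \<le> p \<Longrightarrow> p \<le> 1 \<Longrightarrow> eta p \<le> e"
proof -
  have "(eta \<longlongrightarrow> 0) (at_right 0)" unfolding eta_def by real_asymp
  then have "\<forall>\<^sub>F p in at_right 0. eta p < e" by (rule order_tendstoD) (rule assms)
  then obtain d1 where d1: "d1 > 0" "\<And>p. 0 < p \<Longrightarrow> p < d1 \<Longrightarrow> eta p < e"
    by (auto simp: eventually_at_right_field)
  have "(eta \<longlongrightarrow> 0) (at_left 1)" unfolding eta_def by real_asymp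
  then have "\<forall>\<^sub>F p in at_left 1. eta p < e" by (rule order_tendstoD) (rule assms)
  then obtain d2 where d2: "d2 < 1" "\<And>p. d2 < p \<Longrightarrow> p < 1 \<Longrightarrow> eta p < e"
    by (auto simp: eventually_at_left_field)
  define d where "d = min d1 (1 - d2) / 2"
  have d: "0 < d" "d < d1" "d2 < 1 - d" using d1(1) d2(1) by (auto simp: d_def min_def field_simps)
  show thesis
  proof (rule that[of d])
    show "0 < d" by fact
    show "eta p \<le> e" if "0 \<le> p" "p \<le> d" for p
      using that d d1(2)[of p] assms by (cases "p = 0") (auto simp: less_imp_le)
    show "eta p \<le> e" if "1 - d \<le> p" "p \<le> 1" for p
      using that d d2(2)[of p] assms by (cases "p = 1") (auto simp: less_imp_le)
  qed
qed

text \<open>Shannon entropy with natural logarithm, for a random variable instead of a partition: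
  refinement becomes factoring through a function, and a join becomes a pair.\<close>

definition ent :: "'x measure \<Rightarrow> ('x \<Rightarrow> 'b) \<Rightarrow> real" where
  "ent M f = (\<Sum>v\<in>f ` space M. eta (measure M (f -` {v} \<inter> space M)))"

lemma ent_cong: "(\<And>x. x \<in> space M \<Longrightarrow> f x = g x) \<Longrightarrow> ent M f = ent M g"
  unfolding ent_def by (rule sum.cong) (auto intro!: arg_cong[where f = eta] arg_cong[where f = "measure M"])

lemma ent_superset:
  assumes "finite S" "f ` space M \<subseteq> S"
  shows "ent M f = (\<Sum>v\<in>S. eta (measure M (f -` {v} \<inter> space M)))"
  unfolding ent_def
proof (rule sum.mono_neutral_left[OF assms], rule ballI)
  fix v assume "v \<in> S - f ` space M"
  then have "f -` {v} \<inter> space M = {}" by auto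
  then show "eta (measure M (f -` {v} \<inter> space M)) = 0" by simp
qed

context prob_space
begin

lemma ent_nonneg: "0 \<le> ent M f"
  unfolding ent_def by (intro sum_nonneg eta_nonneg) auto

lemma ent_eq_entropy:
  assumes "simple_function M f"
  shows "ent M f = entropy (exp 1) (count_space (f ` space M)) f"
proof -
  interpret information_space M "exp 1" by standard simp
  show ?thesis
    by (subst entropy_simple_distributed[OF simple_distributedI[OF assms measure_nonneg refl]])
       (simp add: ent_def eta_def sum_negf log_def)
qed

lemma ent_compose:
  assumes "simple_function M f"
  shows "ent M (\<lambda>x. g (f x)) \<le> ent M f"
proof -
  interpret information_space M "exp 1" by standard simp
  have "simple_function M (\<lambda>x. g (f x))" using simple_function_compose[OF assms, of g] by (simp add: o_def)
  then show ?thesis using entropy_data_processing[OF assms, of g] assms by (simp add: ent_eq_entropy o_def)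
qed

lemma ent_factor:
  assumes "simple_function M f" "\<And>x. x \<in> space M \<Longrightarrow> h x = g (f x)"
  shows "ent M h \<le> ent M f"
  using ent_compose[OF assms(1), of g] ent_cong[of M h "\<lambda>x. g (f x)"] assms(2) by simp

lemma ent_Pair:
  assumes "simple_function M f" "simple_function M g"
  shows "ent M (\<lambda>x. (f x, g x)) \<le> ent M f + ent M g"
proof -
  interpret information_space M "exp 1" by standard simp
  show ?thesis
    using entropy_chain_rule[OF assms] conditional_entropy_less_eq_entropy[OF assms(2,1)]
    by (simp add: ent_eq_entropy assms simple_function_Pair)
qed

lemma simple_function_map:
  assumes "\<And>i. i < n \<Longrightarrow> simple_function M (f i)"
  shows "simple_function M (\<lambda>x. map (\<lambda>i. f i x) [0..<n])"
  using assms
proof (induction n)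
  case (Suc n)
  have "simple_function M (\<lambda>x. (map (\<lambda>i. f i x) [0..<n], f n x))"
    using Suc by (intro simple_function_Pair) auto
  from simple_function_compose[OF this, of "\<lambda>(u, v). u @ [v]"] show ?case by (simp add: o_def)
qed simp

lemma ent_map:
  assumes "\<And>i. i < n \<Longrightarrow> simple_function M (f i)"
  shows "ent M (\<lambda>x. map (\<lambda>i. f i x) [0..<n]) \<le> (\<Sum>i<n. ent M (f i))"
  using assms
proof (induction n)
  case 0
  have "ent M (\<lambda>x. [] :: 'b list) = 0"
  proof -
    have *: "(\<lambda>x. [] :: 'b list) ` space M = {[]}" using not_empty by auto
    show ?thesis unfolding ent_def * by (simp add: prob_space)
  qed
  then show ?case by simp
next
  case (Suc n)
  have sf: "simple_function M (\<lambda>x. map (\<lambda>i. f i x) [0..<n])" "simple_function M (f n)"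
    using Suc.prems by (auto intro: simple_function_map)
  have "ent M (\<lambda>x. map (\<lambda>i. f i x) [0..<Suc n]) \<le> ent M (\<lambda>x. (map (\<lambda>i. f i x) [0..<n], f n x))"
    by (rule ent_factor[OF simple_function_Pair[OF sf], of _ "\<lambda>(u, v). u @ [v]"]) simp
  also have "\<dots> \<le> ent M (\<lambda>x. map (\<lambda>i. f i x) [0..<n]) + ent M (f n)"
    by (rule ent_Pair[OF sf])
  finally show ?case using Suc by force
qed

lemma ent_le_ln_card:
  assumes "simple_function M f"
  shows "ent M f \<le> ln (real (card (f ` space M)))"
proof -
  interpret information_space M "exp 1" by standard simp
  show ?thesis using entropy_le_card[OF simple_distributedI[OF assms measure_nonneg refl]] by (simp add: ent_eq_entropy assms log_def)
qed

end

section \<open>Clopen sets and measures on the sequence space\<close>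

definition depends :: "nat \<Rightarrow> (nat \<Rightarrow> 'a) set \<Rightarrow> bool" where
  "depends n C \<longleftrightarrow> (\<forall>x y. prefix n x = prefix n y \<longrightarrow> x \<in> C \<longrightarrow> y \<in> C)"

definition clopens :: "(nat \<Rightarrow> 'a) set set" where
  "clopens = {C. \<exists>n. depends n C}"

lemma depends_mono: "depends m C \<Longrightarrow> m \<le> n \<Longrightarrow> depends n C"
proof -
  assume C: "depends m C" and "m \<le> n"
  have "prefix m x = prefix m y" if "prefix n x = prefix n y" for x y :: "nat \<Rightarrow> 'a"
    using that \<open>m \<le> n\<close> by (auto simp: prefix_eq_iff)
  then show "depends n C" using C unfolding depends_def by blast
qed

lemma depends_prefix: "depends n {x. prefix n x \<in> S}"
  by (simp add: depends_def)

lemma dependsI: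
  assumes "\<And>x y. prefix n x = prefix n y \<Longrightarrow> x \<in> C \<Longrightarrow> y \<in> C"
  shows "depends n C"
  unfolding depends_def by (intro allI impI) (rule assms)

lemma dependsD: "depends n C \<Longrightarrow> prefix n x = prefix n y \<Longrightarrow> x \<in> C \<Longrightarrow> y \<in> C"
  unfolding depends_def by (elim allE impE) assumption

lemma depends_eq: "depends n C \<Longrightarrow> C = {x. prefix n x \<in> prefix n ` C}"
proof (intro set_eqI iffI)
  fix x assume C: "depends n C" and "x \<in> {x. prefix n x \<in> prefix n ` C}"
  then obtain y where "y \<in> C" "prefix n y = prefix n x" by force
  then show "x \<in> C" by (rule dependsD[OF C, rotated])
qed simp

lemma clopens_common:
  assumes "C \<in> clopens" "D \<in> clopens"
  obtains n where "depends n C" "depends n D"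
proof -
  obtain k l where "depends k C" "depends l D" using assms unfolding clopens_def by auto
  then show thesis
    by (intro that[of "max k l"]) (erule depends_mono, simp)+
qed

lemma depends_Un: "depends n C \<Longrightarrow> depends n D \<Longrightarrow> depends n (C \<union> D)"
  by (rule dependsI, erule UnE) (rule UnI1, rule dependsD, assumption+, rule UnI2, rule dependsD, assumption+)

lemma depends_Compl: "depends n C \<Longrightarrow> depends n (UNIV - C)"
  by (rule dependsI, rule DiffI, rule UNIV_I, rule notI, erule DiffE, erule notE, rule dependsD, assumption, rule sym)

lemma algebra_clopens: "algebra UNIV (clopens :: (nat \<Rightarrow> 'a) set set)"
  unfolding algebra_iff_Un
proof (intro conjI ballI)
  have "depends 0 ({} :: (nat \<Rightarrow> 'a) set)" by (simp add: depends_def)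
  then show "{} \<in> (clopens :: (nat \<Rightarrow> 'a) set set)" unfolding clopens_def by blast
next
  fix C :: "(nat \<Rightarrow> 'a) set" assume "C \<in> clopens"
  then obtain n where "depends n C" unfolding clopens_def by blast
  then have "depends n (UNIV - C)" by (rule depends_Compl)
  then show "UNIV - C \<in> clopens" unfolding clopens_def by blast
next
  fix C D :: "(nat \<Rightarrow> 'a) set" assume "C \<in> clopens" "D \<in> clopens"
  then obtain n where "depends n C" "depends n D" by (rule clopens_common)
  then have "depends n (C \<union> D)" by (rule depends_Un)
  then show "C \<union> D \<in> clopens" unfolding clopens_def by blast
qed simp

interpretation clopens: algebra UNIV clopens
  by (rule algebra_clopens)

lemma space_SM [simp]: "space SM = UNIV"
  by (simp add: SM_def space_PiM)

lemma coord_measurable: "(\<lambda>x. x i) \<in> measurable SM (count_space UNIV)"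
  unfolding SM_def by (rule measurable_component_singleton) simp

lemma prefix_set: "{x. prefix n x = w} \<in> sets SM"
proof (cases "length w = n")
  case True
  have "{x. prefix n x = w} = (\<Inter>i<n. (\<lambda>x. x i) -` {w ! i} \<inter> space SM) \<inter> space SM"
    using True by (auto simp: list_eq_iff_nth_eq)
  also have "\<dots> \<in> sets SM"
    using measurable_sets[OF coord_measurable, of "{_}"] sets.top[of SM]
    by (cases "n = 0") (auto intro!: sets.Int sets.finite_INT)
  finally show ?thesis .
next
  case False
  then have "{x. prefix n x = w} = {}" by auto
  then show ?thesis by simp
qed

lemma clopen_sets: "C \<in> clopens \<Longrightarrow> C \<in> sets (SM :: (nat \<Rightarrow> 'a::finite) measure)"
proof -
  assume "C \<in> clopens"
  then obtain n where "depends n C" by (auto simp: clopens_def)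
  then have "C = (\<Union>w\<in>prefix n ` C. {x. prefix n x = w})" 
    by (subst depends_eq) auto
  also have "\<dots> \<in> sets SM"
  proof (rule sets.finite_UN)
    show "finite (prefix n ` C)" by (rule finite_subset[of _ "words n"]) auto
  qed (rule prefix_set)
  finally show ?thesis .
qed

lemma sets_SM: "sets (SM :: (nat \<Rightarrow> 'a::finite) measure) = sigma_sets UNIV clopens"
proof
  have sub: "{{f \<in> UNIV. f i \<in> A} | i (A :: 'a set). i \<in> (UNIV :: nat set) \<and> A \<in> UNIV} \<subseteq> clopens"
  proof safe
    fix i and A :: "'a set"
    have "depends (Suc i) {f \<in> UNIV. f i \<in> A}" by (rule dependsI) (auto simp: prefix_eq_iff)
    then show "{f \<in> UNIV. f i \<in> A} \<in> clopens" unfolding clopens_def by blast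
  qed
  have "sets (SM :: (nat \<Rightarrow> 'a) measure) = sigma_sets UNIV {{f \<in> UNIV. f i \<in> A} | i (A :: 'a set). i \<in> (UNIV :: nat set) \<and> A \<in> UNIV}"
    unfolding SM_def sets_PiM_single by simp
  also have "\<dots> \<subseteq> sigma_sets UNIV clopens" by (rule sigma_sets_mono'[OF sub])
  finally show "sets (SM :: (nat \<Rightarrow> 'a) measure) \<subseteq> sigma_sets UNIV clopens" .
  have "sigma_sets (space SM) clopens \<subseteq> sets (SM :: (nat \<Rightarrow> 'a) measure)"
    by (rule sets.sigma_sets_subset) (auto intro: clopen_sets)
  then show "sigma_sets UNIV clopens \<subseteq> sets (SM :: (nat \<Rightarrow> 'a) measure)" by simp
qed

lemma shift_measurable: "shift \<in> measurable SM SM"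
  unfolding SM_def
  by (rule measurable_PiM_single') (auto simp: shift_def intro!: measurable_component_singleton)

lemma shift_pow_measurable: "shift ^^ k \<in> measurable SM SM"
proof (induction k)
  case (Suc k)
  then show ?case unfolding funpow.simps by (rule measurable_comp[OF _ shift_measurable])
qed (simp add: id_def)

locale shift_prob = prob_space M for M :: "(nat \<Rightarrow> 'a::finite) measure" +
  assumes sets_M: "sets M = sets SM"
begin

lemma space_M [simp]: "space M = UNIV"
  using sets_eq_imp_space_eq[OF sets_M] by simp

lemma clopen_M: "C \<in> clopens \<Longrightarrow> C \<in> sets M"
  by (simp add: sets_M clopen_sets)

lemma simple_prefix: "simple_function M (prefix n)"
  unfolding simple_function_def
proof (intro conjI ballI)
  show "finite (prefix n ` space M)" by (rule finite_subset[of _ "words n"]) auto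
  show "prefix n -` {w} \<inter> space M \<in> sets M" for w
    using prefix_set[of n w] by (simp add: sets_M vimage_def)
qed

lemma simple_compose: "simple_function M f \<Longrightarrow> simple_function M (\<lambda>x. g (f x))"
  using simple_function_compose[of M f g] by (simp add: o_def)

text \<open>The approximable sets form a sigma-algebra containing the clopen sets. A complement has
  the same symmetric difference. A countable union is cut to a finite one at cost e/2, and its
  members share the other half.\<close>

lemma clopen_approx:
  assumes "A \<in> sets M" "e > 0"
  shows "\<exists>C\<in>clopens. measure M ((A - C) \<union> (C - A)) < e"
proof -
  have "A \<in> sigma_sets UNIV clopens" using assms by (simp add: sets_M sets_SM)
  then show ?thesis using \<open>e > 0\<close>
  proof (induction A arbitrary: e rule: sigma_sets.induct)
    case (Basic A)
    then show ?case by (intro bexI[of _ A]) auto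
  next
    case Empty
    then show ?case by (intro bexI[of _ "{}"]) auto
  next
    case (Compl A)
    then obtain C where C: "C \<in> clopens" "measure M ((A - C) \<union> (C - A)) < e" by blast
    have "(UNIV - A - (UNIV - C)) \<union> (UNIV - C - (UNIV - A)) = (A - C) \<union> (C - A)" by auto
    then show ?case using C clopens.compl_sets[OF C(1)] by (intro bexI[of _ "UNIV - C"]) auto
  next
    case (Union A)
    have A: "A i \<in> sets M" for i using Union.hyps by (simp add: sets_M sets_SM)
    let ?U = "\<Union>i. A i"
    have "(\<lambda>N. measure M (\<Union>i<N. A i)) \<longlonglongrightarrow> measure M (\<Union>N. \<Union>i<N. A i)"
    proof (rule finite_Lim_measure_incseq)
      show "range (\<lambda>N. \<Union>i<N. A i) \<subseteq> sets M" using A by (auto intro!: sets.finite_UN)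
      show "incseq (\<lambda>N. \<Union>i<N. A i)" by (intro monoI UN_mono) auto
    qed
    also have "(\<Union>N. \<Union>i<N. A i) = ?U" by blast
    finally have "\<forall>\<^sub>F N in sequentially. measure M ?U - e / 2 < measure M (\<Union>i<N. A i)"
      by (rule order_tendstoD(1)) (use Union.prems in simp)
    then obtain N where N: "measure M ?U - e / 2 < measure M (\<Union>i<N. A i)"
      by (auto simp: eventually_sequentially)
    \<comment> \<open>\<open>N + 1\<close> rather than \<open>N\<close> keeps \<open>d\<close>
      positive when \<open>N = 0\<close>.\<close>
    define d where "d = e / (2 * (real N + 1))"
    have "\<exists>C\<in>clopens. measure M ((A i - C) \<union> (C - A i)) < d" for i
      using Union.prems by (intro Union.IH) (auto simp: d_def)
    then obtain C where C: "\<And>i. C i \<in> clopens" "\<And>i. measure M ((A i - C i) \<union> (C i - A i)) < d"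
      by metis
    let ?C = "\<Union>i<N. C i"
    have Cl: "?C \<in> clopens" using C(1) by (intro clopens.finite_UN) auto
    have sets: "?U - (\<Union>i<N. A i) \<in> sets M" "(\<Union>i<N. (A i - C i) \<union> (C i - A i)) \<in> sets M"
      using A clopen_M[OF C(1)] by (intro sets.Diff sets.finite_UN sets.countable_UN sets.Un; auto)+
    have "measure M ((?U - ?C) \<union> (?C - ?U)) \<le> measure M ((?U - (\<Union>i<N. A i)) \<union> (\<Union>i<N. (A i - C i) \<union> (C i - A i)))"
      by (intro finite_measure_mono sets.Un sets) auto
    also have "\<dots> \<le> measure M (?U - (\<Union>i<N. A i)) + measure M (\<Union>i<N. (A i - C i) \<union> (C i - A i))"
      by (intro measure_Un_le sets)
    also have "measure M (?U - (\<Union>i<N. A i)) = measure M ?U - measure M (\<Union>i<N. A i)"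
      using A by (intro finite_measure_Diff) (auto intro!: sets.finite_UN sets.countable_UN)
    also have "measure M (\<Union>i<N. (A i - C i) \<union> (C i - A i)) \<le> (\<Sum>i<N. measure M ((A i - C i) \<union> (C i - A i)))"
      using A clopen_M[OF C(1)] by (intro finite_measure_subadditive_finite) auto
    also have "\<dots> \<le> (\<Sum>i<N. d)" using C(2) by (intro sum_mono less_imp_le) auto
    also have "(\<Sum>i<N. d) \<le> e / 2" using Union.prems by (simp add: d_def field_simps)
    finally have "measure M ((?U - ?C) \<union> (?C - ?U)) < e" using N by linarith
    then show ?case using Cl by blast
  qed
qed

end

lemma shift_prob_eqI:
  assumes "shift_prob M" "shift_prob N" "\<And>C. C \<in> clopens \<Longrightarrow> measure M C = measure N C"
  shows "M = N"
proof -
  interpret M: shift_prob M by fact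
  interpret N: shift_prob N by fact
  show ?thesis
  proof (rule measure_eqI_generator_eq[of clopens UNIV M N "\<lambda>_. UNIV"])
    show "Int_stable clopens" by (auto simp: Int_stable_def)
    show "emeasure M C = emeasure N C" if "C \<in> clopens" for C
      using assms(3)[OF that] by (simp add: M.emeasure_eq_measure N.emeasure_eq_measure)
    show "range (\<lambda>_. UNIV) \<subseteq> clopens" using clopens.top by auto
  qed (auto simp: M.sets_M N.sets_M sets_SM)
qed

lemma shift_prob_distr: "shift_prob M \<Longrightarrow> shift_prob (distr M SM (shift ^^ k))"
proof -
  assume "shift_prob M"
  then interpret shift_prob M .
  have "shift ^^ k \<in> measurable M SM"
    using shift_pow_measurable measurable_cong_sets[OF sets_M refl] by blast
  then show ?thesis by (intro shift_prob.intro prob_space_distr) (simp_all add: shift_prob_axioms_def)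
qed

locale shift_inv = shift_prob +
  assumes invariant: "A \<in> sets SM \<Longrightarrow> emeasure M (shift -` A) = emeasure M A"

lemma inv_probs_iff: "M \<in> inv_probs \<longleftrightarrow> shift_inv M"
  by (auto simp: inv_probs_def shift_inv_def shift_inv_axioms_def shift_prob_def shift_prob_axioms_def)

lemma shift_vimage: "A \<in> sets SM \<Longrightarrow> (shift ^^ k) -` A \<in> sets SM"
  using measurable_sets[OF shift_pow_measurable, of A k] by simp

context shift_inv
begin

lemma invariant_pow: "A \<in> sets SM \<Longrightarrow> measure M ((shift ^^ k) -` A) = measure M A"
proof (induction k)
  case (Suc k)
  have "(shift ^^ Suc k) -` A = shift -` ((shift ^^ k) -` A)"
    by (auto simp: funpow_swap1)
  then show ?case
    using Suc invariant[OF shift_vimage[OF Suc.prems, of k]] unfolding measure_def by (simp only: not_False_eq_True)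
qed simp

lemma simple_shift:
  assumes "simple_function M f"
  shows "simple_function M (\<lambda>x. f ((shift ^^ k) x))"
  unfolding simple_function_def
proof (intro conjI ballI)
  have f: "finite (range f)" "\<And>v. f -` {v} \<in> sets SM"
    using assms simple_functionD(2)[OF assms] by (auto simp: simple_function_def sets_M)
  show "finite ((\<lambda>x. f ((shift ^^ k) x)) ` space M)"
    by (rule finite_subset[OF _ f(1)]) auto
  have "(\<lambda>x. f ((shift ^^ k) x)) -` {v} \<inter> space M = (shift ^^ k) -` (f -` {v})" for v by auto
  then show "(\<lambda>x. f ((shift ^^ k) x)) -` {v} \<inter> space M \<in> sets M" for v
    using shift_vimage[OF f(2)] by (simp add: sets_M)
qed

lemma ent_shift:
  assumes "simple_function M f"
  shows "ent M (\<lambda>x. f ((shift ^^ k) x)) = ent M f"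
proof -
  have f: "finite (range f)" "\<And>v. f -` {v} \<in> sets SM"
    using assms simple_functionD(2)[OF assms] by (auto simp: simple_function_def sets_M)
  have "measure M ((\<lambda>x. f ((shift ^^ k) x)) -` {v}) = measure M (f -` {v})" for v
    using invariant_pow[OF f(2), of k v] by (simp add: vimage_def)
  then show ?thesis
    using ent_superset[of "range f" "\<lambda>x. f ((shift ^^ k) x)" M] f(1)
    by (simp add: ent_superset[of "range f" f M] image_subset_iff)
qed

section \<open>Block entropy and the Kolmogorov-Sinai theorem\<close>

definition wordent :: "nat \<Rightarrow> real" where "wordent n = ent M (prefix n)"

lemma ent_map_shift_add:
  assumes f: "simple_function M f"
  shows "ent M (\<lambda>x. map (\<lambda>i. f ((shift ^^ i) x)) [0..<m + n])
       \<le> ent M (\<lambda>x. map (\<lambda>i. f ((shift ^^ i) x)) [0..<m]) + ent M (\<lambda>x. map (\<lambda>i. f ((shift ^^ i) x)) [0..<n])"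
proof -
  let ?F = "\<lambda>n x. map (\<lambda>i. f ((shift ^^ i) x)) [0..<n]"
  have sf: "simple_function M (?F n)" for n by (intro simple_function_map simple_shift f)
  have "?F (m + n) x = ?F m x @ ?F n ((shift ^^ m) x)" for x
    by (rule nth_equalityI) (auto simp: nth_append shift_pow add.assoc)
  then have "ent M (?F (m + n)) \<le> ent M (\<lambda>x. (?F m x, ?F n ((shift ^^ m) x)))"
    by (intro ent_factor[of _ _ "\<lambda>(u, v). u @ v"] simple_function_Pair simple_shift[OF sf] sf) auto
  also have "\<dots> \<le> ent M (?F m) + ent M (\<lambda>x. ?F n ((shift ^^ m) x))"
    by (intro ent_Pair sf simple_shift[OF sf])
  also have "ent M (\<lambda>x. ?F n ((shift ^^ m) x)) = ent M (?F n)"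
    by (rule ent_shift[OF sf])
  finally show ?thesis .
qed

lemma ent_map_shift_converges:
  assumes f: "simple_function M f"
  obtains l where "(\<lambda>n. ent M (\<lambda>x. map (\<lambda>i. f ((shift ^^ i) x)) [0..<n]) / real n) \<longlonglongrightarrow> l"
    "\<And>n. n \<ge> 1 \<Longrightarrow> l \<le> ent M (\<lambda>x. map (\<lambda>i. f ((shift ^^ i) x)) [0..<n]) / real n"
  using Fekete[of "\<lambda>n. ent M (\<lambda>x. map (\<lambda>i. f ((shift ^^ i) x)) [0..<n])", OF ent_map_shift_add[OF f] ent_nonneg]
  by blast

lemma prefix_as_map: "prefix n = (\<lambda>x. map (\<lambda>i. ((shift ^^ i) x) 0) [0..<n])"
  by (auto simp: prefix_def)

lemma simple_coord: "simple_function M (\<lambda>x. x 0)"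
  using simple_compose[OF simple_prefix[of 1], of hd] by (simp add: prefix_def)

definition hword :: real where "hword = lim (\<lambda>n. wordent n / real n)"

lemma
  shows wordent_lim: "(\<lambda>n. wordent n / real n) \<longlonglongrightarrow> hword"
    and hword_le: "n \<ge> 1 \<Longrightarrow> hword \<le> wordent n / real n"
proof -
  obtain l where l: "(\<lambda>n. wordent n / real n) \<longlonglongrightarrow> l" "\<And>n. n \<ge> 1 \<Longrightarrow> l \<le> wordent n / real n"
    using ent_map_shift_converges[OF simple_coord] unfolding wordent_def prefix_as_map by blast
  then have "hword = l" unfolding hword_def by (intro limI)
  then show "(\<lambda>n. wordent n / real n) \<longlonglongrightarrow> hword" "n \<ge> 1 \<Longrightarrow> hword \<le> wordent n / real n"
    using l by auto
qed

lemma wordent_add: "wordent (m + n) \<le> wordent m + wordent n"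
  unfolding wordent_def prefix_as_map by (rule ent_map_shift_add[OF simple_coord])

text \<open>For a partition this is a singleton. Collecting all matching members keeps the formula
  meaningful when the cells are replaced by approximations that may overlap or fail to cover the
  space.\<close>

definition cell :: "(nat \<Rightarrow> 'a) set set \<Rightarrow> (nat \<Rightarrow> 'a) \<Rightarrow> (nat \<Rightarrow> 'a) set set" where
  "cell P x = {A \<in> P. x \<in> A}"

lemma simple_cell:
  assumes "finite P" "\<And>A. A \<in> P \<Longrightarrow> S A \<in> sets M"
  shows "simple_function M (\<lambda>x. {A \<in> P. x \<in> S A})"
  unfolding simple_function_def
proof (intro conjI ballI)
  show "finite ((\<lambda>x. {A \<in> P. x \<in> S A}) ` space M)"
    by (rule finite_subset[of _ "Pow P"]) (use assms in auto)
  fix V assume "V \<in> (\<lambda>x. {A \<in> P. x \<in> S A}) ` space M"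
  then have "(\<lambda>x. {A \<in> P. x \<in> S A}) -` {V} \<inter> space M
    = {x \<in> space M. \<forall>A\<in>P. (A \<in> V) = (x \<in> S A)}" by auto
  also have "\<dots> = space M \<inter> (\<Inter>A\<in>P. if A \<in> V then S A else space M - S A)" by (auto split: if_splits)
  also have "\<dots> \<in> sets M"
  proof (cases "P = {}")
    case False
    moreover have "UNIV - S A \<in> sets M" if "A \<in> P" for A
      using sets.compl_sets[OF assms(2)[OF that]] by simp
    moreover have "UNIV \<in> sets M" using sets.top[of M] by simp
    ultimately show ?thesis using assms by (intro sets.Int sets.finite_INT) auto
  qed (use sets.top[of M] in simp)
  finally show "(\<lambda>x. {A \<in> P. x \<in> S A}) -` {V} \<inter> space M \<in> sets M" .
qed

text \<open>A choice of cells \<open>w\<close> corresponds to the itinerary listing the singletons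
  of its cells. Choices that no point realizes give empty sets, which contribute nothing to either
  side.\<close>

lemma join_entropy_eq:
  assumes "P \<in> fin_partitions M"
  shows "join_entropy M P n = ent M (\<lambda>x. map (\<lambda>i. cell P ((shift ^^ i) x)) [0..<n])"
proof -
  let ?F = "\<lambda>x. map (\<lambda>i. cell P ((shift ^^ i) x)) [0..<n]"
  let ?W = "PiE {0..<n} (\<lambda>_. P)"
  let ?l = "\<lambda>w. map (\<lambda>i. {w i}) [0..<n]"
  have P: "finite P" "\<Union>P = UNIV" "\<And>A B. A \<in> P \<Longrightarrow> B \<in> P \<Longrightarrow> A \<noteq> B \<Longrightarrow> A \<inter> B = {}"
    using assms by (auto simp: fin_partitions_def)
  have cell_iff: "cell P x = {A} \<longleftrightarrow> x \<in> A" if "A \<in> P" for x A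
    using that P(3) by (auto simp: cell_def)
  have cell_ex: "\<exists>A\<in>P. cell P x = {A}" for x
    using P(2) cell_iff by (metis UNIV_I UnionE)
  have inj: "inj_on ?l ?W"
    by (rule inj_onI) (auto intro!: PiE_ext)
  have sub: "range ?F \<subseteq> ?l ` ?W"
  proof safe
    fix x
    obtain A where A: "\<And>y. A y \<in> P" "\<And>y. cell P y = {A y}" using cell_ex by metis
    have eq: "?F x = ?l (restrict (\<lambda>i. A ((shift ^^ i) x)) {0..<n})" by (simp add: A)
    have "restrict (\<lambda>i. A ((shift ^^ i) x)) {0..<n} \<in> ?W" using A(1) by auto
    then show "?F x \<in> ?l ` ?W" unfolding eq by (rule imageI)
  qed
  have pre: "?F -` {?l w} = (\<Inter>i\<in>{0..<n}. (shift ^^ i) -` (w i))" if "w \<in> ?W" for w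
  proof -
    have w: "w i \<in> P" if "i < n" for i using \<open>w \<in> ?W\<close> that by auto
    have "?F x = ?l w \<longleftrightarrow> (\<forall>i<n. (shift ^^ i) x \<in> w i)" for x
      using cell_iff[OF w] by (auto simp del: shift_pow_nth)
    then show ?thesis by (auto simp del: shift_pow_nth)
  qed
  have "ent M ?F = (\<Sum>v\<in>?l ` ?W. eta (measure M (?F -` {v} \<inter> space M)))"
    using sub P(1) by (intro ent_superset finite_imageI finite_PiE) auto
  also have "\<dots> = (\<Sum>w\<in>?W. eta (measure M (?F -` {?l w} \<inter> space M)))"
    by (simp add: sum.reindex[OF inj])
  also have "\<dots> = (\<Sum>w\<in>?W. eta (measure M (\<Inter>i\<in>{0..<n}. (shift ^^ i) -` (w i))))"
    by (intro sum.cong) (simp_all only: pre space_M Int_UNIV_right)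
  finally show ?thesis by (simp add: join_entropy_def eta_def sum_negf Let_def)
qed

text \<open>Approximating each cell by a clopen set replaces the partition by a function of a prefix, at
  the price of an error variable that is rarely nontrivial and hence has small entropy.\<close>

lemma part_entropy_approx:
  assumes P: "P \<in> fin_partitions M" and e: "e > 0"
  shows "\<exists>m. \<forall>n. ent M (\<lambda>x. map (\<lambda>i. cell P ((shift ^^ i) x)) [0..<n]) \<le> wordent (n + m) + real n * e"
proof -
  have finP: "finite P" and PM: "\<And>A. A \<in> P \<Longrightarrow> A \<in> sets M"
    using P by (auto simp: fin_partitions_def)
  \<comment> \<open>A finite set containing all values of the error variable; each is allowed the
    share \<open>e / card S\<close> of the entropy.\<close>
  define S where "S = insert None (Some ` Pow P)"
  have finS: "finite S" using finP by (simp add: S_def)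
  have cS: "real (card S) > 0" using finS by (auto simp: S_def card_gt_0_iff)
  obtain d where d: "d > 0" "\<And>p. 0 \<le> p \<Longrightarrow> p \<le> d \<Longrightarrow> eta p \<le> e / card S"
      "\<And>p. 1 - d \<le> p \<Longrightarrow> p \<le> 1 \<Longrightarrow> eta p \<le> e / card S"
    using eta_small[of "e / card S"] e cS by auto
  define d' where "d' = d / (real (card P) + 1)"
  have "d' > 0" using d(1) by (simp add: d'_def add_nonneg_pos)
  then have "\<exists>C\<in>clopens. measure M ((A - C) \<union> (C - A)) < d'" if "A \<in> P" for A
    using clopen_approx[OF PM[OF that]] by blast
  then obtain C where C: "\<And>A. A \<in> P \<Longrightarrow> C A \<in> clopens" "\<And>A. A \<in> P \<Longrightarrow> measure M ((A - C A) \<union> (C A - A)) < d'"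
    by metis
  have CM: "\<And>A. A \<in> P \<Longrightarrow> C A \<in> sets M" using C(1) clopen_M by blast
  have "\<forall>A\<in>P. \<exists>k. depends k (C A)" using C(1) unfolding clopens_def by blast
  then obtain k where k: "\<And>A. A \<in> P \<Longrightarrow> depends (k A) (C A)" by metis
  define m where "m = (\<Sum>A\<in>P. k A)"
  have m: "depends m (C A)" if "A \<in> P" for A
    using k[OF that] by (rule depends_mono) (auto simp: m_def intro: member_le_sum finP that)
  define f where "f = cell P"
  define g where "g x = {A \<in> P. x \<in> C A}" for x
  define err where "err x = (if f x = g x then None else Some (f x))" for x
  define G where "G u = {A \<in> P. u \<in> prefix m ` C A}" for u
  have gG: "g x = G (prefix m x)" for x
    using depends_eq[OF m] by (auto simp: g_def G_def)
  have sf: "simple_function M f"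
    using simple_cell[OF finP, of id] PM by (simp add: f_def cell_def[abs_def])
  have sg: "simple_function M g"
    using simple_cell[OF finP CM] by (simp add: g_def[abs_def])
  have se: "simple_function M err"
    using simple_compose[OF simple_function_Pair[OF sf sg], of "\<lambda>(u, v). if u = v then None else Some u"]
    by (simp add: err_def[abs_def])
  define B where "B = (\<Union>A\<in>P. (A - C A) \<union> (C A - A))"
  have BM: "B \<in> sets M" unfolding B_def using PM CM finP by (intro sets.finite_UN sets.Un sets.Diff) auto
  have "measure M B \<le> (\<Sum>A\<in>P. measure M ((A - C A) \<union> (C A - A)))"
    unfolding B_def using PM CM finP by (intro finite_measure_subadditive_finite) auto
  also have "\<dots> \<le> (\<Sum>A\<in>P. d')" using C(2) by (intro sum_mono less_imp_le)
  also have "\<dots> \<le> d" using d(1) by (simp add: d'_def field_simps)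
  finally have B: "measure M B \<le> d" .
  have errB: "x \<in> B" if "err x \<noteq> None" for x
    using that by (auto simp: err_def f_def g_def cell_def B_def split: if_splits)
  have "ent M err = (\<Sum>v\<in>S. eta (measure M (err -` {v} \<inter> space M)))"
    by (rule ent_superset[OF finS]) (auto simp: S_def err_def f_def cell_def)
  also have "\<dots> \<le> (\<Sum>v\<in>S. e / card S)"
  proof (rule sum_mono)
    fix v assume "v \<in> S"
    show "eta (measure M (err -` {v} \<inter> space M)) \<le> e / card S"
    proof (cases "v = None")
      case True
      have "1 - d \<le> 1 - measure M B" using B by simp
      also have "\<dots> = measure M (space M - B)" using prob_compl[OF BM] by simp
      also have "\<dots> \<le> measure M (err -` {v} \<inter> space M)"
      proof (rule finite_measure_mono)
        have "err x = None" if "x \<notin> B" for x using errB[of x] that by blast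
        then show "space M - B \<subseteq> err -` {v} \<inter> space M" using True by auto
      qed (rule simple_functionD(2)[OF se])
      finally show ?thesis using d(3) by simp
    next
      case False
      then have "measure M (err -` {v} \<inter> space M) \<le> measure M B"
        using errB by (intro finite_measure_mono BM) auto
      then show ?thesis using d(2) B by simp
    qed
  qed
  also have "\<dots> = e" using cS by simp
  finally have ent_err: "ent M err \<le> e" .
  show ?thesis
  proof (intro exI[of _ m] allI)
    fix n
    let ?E = "\<lambda>x. map (\<lambda>i. err ((shift ^^ i) x)) [0..<n]"
    let ?rec = "\<lambda>(w, es). map (\<lambda>i. case es ! i of None \<Rightarrow> G (take m (drop i w)) | Some v \<Rightarrow> v) [0..<n]"
    have sE: "simple_function M ?E" by (intro simple_function_map simple_shift se)
    have "map (\<lambda>i. f ((shift ^^ i) x)) [0..<n] = ?rec (prefix (n + m) x, ?E x)" for x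
    proof -
      have "f ((shift ^^ i) x) = (case err ((shift ^^ i) x) of None \<Rightarrow> G (take m (drop i (prefix (n + m) x))) | Some v \<Rightarrow> v)"
        if "i < n" for i
      proof -
        have "take m (drop i (prefix (n + m) x)) = prefix m ((shift ^^ i) x)"
          using that by (simp only: drop_prefix take_prefix)
        then show ?thesis by (simp only: gG[symmetric]) (simp add: err_def split: option.split)
      qed
      then show ?thesis by (auto simp del: shift_pow_nth)
    qed
    then have "ent M (\<lambda>x. map (\<lambda>i. f ((shift ^^ i) x)) [0..<n]) \<le> ent M (\<lambda>x. (prefix (n + m) x, ?E x))"
      by (intro ent_factor[of _ _ ?rec] simple_function_Pair simple_prefix sE)
    also have "\<dots> \<le> wordent (n + m) + ent M ?E"
      unfolding wordent_def by (intro ent_Pair simple_prefix sE)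
    also have "ent M ?E \<le> (\<Sum>i<n. ent M (\<lambda>x. err ((shift ^^ i) x)))"
      by (intro ent_map simple_shift se)
    also have "\<dots> = real n * ent M err" by (simp add: ent_shift[OF se])
    also have "\<dots> \<le> real n * e" using ent_err by (intro mult_left_mono) auto
    finally have "ent M (\<lambda>x. map (\<lambda>i. f ((shift ^^ i) x)) [0..<n]) \<le> wordent (n + m) + real n * e"
      by (simp del: shift_pow_nth)
    then show "ent M (\<lambda>x. map (\<lambda>i. cell P ((shift ^^ i) x)) [0..<n]) \<le> wordent (n + m) + real n * e"
      unfolding f_def .
  qed
qed

lemma part_entropy_le: 
  assumes P: "P \<in> fin_partitions M"
  shows "part_entropy M P \<le> hword"
proof (rule field_le_epsilon)
  fix e :: real assume e: "e > 0"
  let ?F = "\<lambda>n x. map (\<lambda>i. cell P ((shift ^^ i) x)) [0..<n]"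
  have sf: "simple_function M (cell P)"
    using simple_cell[of P id] P by (auto simp: cell_def[abs_def] fin_partitions_def)
  obtain l where l: "(\<lambda>n. ent M (?F n) / real n) \<longlonglongrightarrow> l" by (rule ent_map_shift_converges[OF sf])
  have l_eq: "part_entropy M P = l"
    unfolding part_entropy_def join_entropy_eq[OF P] by (rule limI[OF l])
  obtain m where m: "\<And>n. ent M (?F n) \<le> wordent (n + m) + real n * e"
    using part_entropy_approx[OF P e] by auto
  have "l \<le> hword + 0 + e"
  proof (rule LIMSEQ_le[OF l])
    show "(\<lambda>n. wordent n / real n + wordent m / real n + e) \<longlonglongrightarrow> hword + 0 + e"
      by (intro tendsto_add wordent_lim tendsto_const lim_const_over_n)
    show "\<exists>N. \<forall>n\<ge>N. ent M (?F n) / real n \<le> wordent n / real n + wordent m / real n + e"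
    proof (intro exI[of _ 1] allI impI)
      fix n :: nat assume "n \<ge> 1"
      moreover have "ent M (?F n) \<le> wordent n + wordent m + real n * e"
        using m[of n] wordent_add[of n m] by linarith
      ultimately show "ent M (?F n) / real n \<le> wordent n / real n + wordent m / real n + e"
        by (simp add: field_simps)
    qed
  qed
  then show "part_entropy M P \<le> hword + e" by (simp add: l_eq)
qed

definition letters :: "(nat \<Rightarrow> 'a) set set" where
  "letters = (\<lambda>c. {x. x 0 = c}) ` UNIV"

lemma letters_partition: "letters \<in> fin_partitions M"
  unfolding fin_partitions_def mem_Collect_eq
proof (intro conjI)
  show "letters \<subseteq> sets M"
  proof (rule subsetI)
    fix A assume "A \<in> letters"
    then obtain c where "A = {x. prefix 1 x = [c]}" by (auto simp: letters_def prefix_def)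
    then show "A \<in> sets M" using prefix_set[of 1 "[c]"] by (simp add: sets_M)
  qed
qed (auto simp: letters_def)

text \<open>The partition by the first letter is a generator. No finite partition exceeds its
  entropy, and its own itineraries determine the words, so it attains the supremum.\<close>

lemma ks_entropy_eq: "ks_entropy M = hword"
proof (rule antisym)
  show "ks_entropy M \<le> hword"
    unfolding ks_entropy_def using letters_partition part_entropy_le by (intro cSUP_least) auto
  \<comment> \<open>Lets the letter be decoded from its cell.\<close>
  have inj: "inj (\<lambda>c :: 'a. {{x. x (0::nat) = c}})"
  proof (rule injI)
    fix c d :: 'a assume "{{x. x (0::nat) = c}} = {{x. x (0::nat) = d}}"
    then have "{x. x (0::nat) = c} = {x. x (0::nat) = d}" by (rule singleton_inject)
    moreover have "(\<lambda>_. c) \<in> {x. x (0::nat) = c}" by simp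
    ultimately have "(\<lambda>_. c) \<in> {x. x (0::nat) = d}" by (rule subst)
    then show "c = d" by simp
  qed
  have simple_letters: "simple_function M (cell letters)"
    using simple_cell[of letters id] letters_partition by (auto simp: cell_def[abs_def] fin_partitions_def)
  have "wordent n \<le> ent M (\<lambda>x. map (\<lambda>i. cell letters ((shift ^^ i) x)) [0..<n])" for n
  proof -
    have cell: "cell letters x = {{y. y 0 = x 0}}" for x :: "nat \<Rightarrow> 'a"
      by (auto simp: cell_def letters_def)
    have eq: "prefix n x = map (inv (\<lambda>c. {{x. x (0::nat) = c}})) (map (\<lambda>i. cell letters ((shift ^^ i) x)) [0..<n])" for x
      by (simp add: cell inv_f_f[OF inj] prefix_def)
    show ?thesis unfolding wordent_def
      by (rule ent_factor[where f = "\<lambda>x. map (\<lambda>i. cell letters ((shift ^^ i) x)) [0..<n]"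
            and g = "map (inv (\<lambda>c. {{x. x (0::nat) = c}}))", OF _ eq])
        (intro simple_function_map simple_shift simple_letters)
  qed
  moreover obtain l where l: "(\<lambda>n. ent M (\<lambda>x. map (\<lambda>i. cell letters ((shift ^^ i) x)) [0..<n]) / real n) \<longlonglongrightarrow> l"
    by (rule ent_map_shift_converges[OF simple_letters])
  ultimately have "hword \<le> l"
    by (intro LIMSEQ_le[OF wordent_lim l] exI[of _ 0] allI impI divide_right_mono) auto
  also have "l = part_entropy M letters"
    unfolding part_entropy_def join_entropy_eq[OF letters_partition] by (rule limI[OF l, symmetric])
  also have "\<dots> \<le> ks_entropy M"
    unfolding ks_entropy_def
    by (rule cSUP_upper[OF letters_partition]) (auto intro!: bdd_aboveI[of _ hword] part_entropy_le)
  finally show "hword \<le> ks_entropy M" .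
qed

text \<open>With its counterpart below, this makes entropy the infimum of block entropy rates. Block
  entropies for a fixed length are continuous in the measure, whence upper semicontinuity.\<close>

lemma ks_entropy_le: "n \<ge> 1 \<Longrightarrow> ks_entropy M \<le> ent M (prefix n) / real n"
  using hword_le by (simp add: ks_entropy_eq wordent_def)

lemma ks_entropy_ge:
  assumes "\<And>n. n \<ge> 1 \<Longrightarrow> c * real n \<le> ent M (prefix n)"
  shows "c \<le> ks_entropy M"
  unfolding ks_entropy_eq
proof (rule LIMSEQ_le_const[OF wordent_lim])
  show "\<exists>N. \<forall>n\<ge>N. c \<le> wordent n / real n"
    using assms by (intro exI[of _ 1]) (auto simp: wordent_def field_simps)
qed

end

section \<open>The potential and its pressure\<close>

context ssubshift
begin

definition exit :: "(nat \<Rightarrow> 'a) \<Rightarrow> nat" where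
  "exit x = (LEAST j. prefix (Suc j) x \<notin> lang (Suc j) X)"

lemma exit_outside:
  assumes "x \<notin> X"
  shows "prefix (Suc (exit x)) x \<notin> lang (Suc (exit x)) X" "prefix (exit x) x \<in> lang (exit x) X"
proof -
  have empty: "[] \<in> lang 0 X" using Nil_in_language by (simp add: language_iff)
  obtain m where m: "prefix m x \<notin> lang m X" using assms in_iff_prefix by blast
  then have "m \<noteq> 0" using empty by (intro notI) (simp add: prefix_def)
  then obtain k where "m = Suc k" using not0_implies_Suc by blast
  then show "prefix (Suc (exit x)) x \<notin> lang (Suc (exit x)) X"
    unfolding exit_def using m LeastI[of "\<lambda>j. prefix (Suc j) x \<notin> lang (Suc j) X" k] by simp
  show "prefix (exit x) x \<in> lang (exit x) X"
  proof (cases "exit x")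
    case 0
    then show ?thesis using empty by (simp add: prefix_def)
  next
    case (Suc k)
    then have "k < exit x" by simp
    then have "\<not> prefix (Suc k) x \<notin> lang (Suc k) X"
      unfolding exit_def by (rule not_less_Least[where P = "\<lambda>j. prefix (Suc j) x \<notin> lang (Suc j) X"])
    then show ?thesis unfolding Suc by simp
  qed
qed

text \<open>The infimum is attained: some point of X shares the first \<open>exit x\<close> letters
  with x, and none shares one letter more.\<close>

lemma setdist_eq:
  assumes x: "x \<notin> X"
  shows "setdist x X = (1/2) ^ exit x"
proof -
  let ?e = "exit x"
  note e = exit_outside[OF x]
  have diff: "\<not> prefix (Suc ?e) x = prefix (Suc ?e) y" if "y \<in> X" for y
    using e(1) that by (auto simp: lang_eq)
  obtain y where y: "y \<in> X" "prefix ?e x = prefix ?e y" using e(2) by (auto simp: lang_eq)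
  have agree: "x i = y i" if "i < ?e" for i using y(2) that by (simp add: prefix_eq_iff)
  have "\<not> (\<forall>i<Suc ?e. x i = y i)" using diff[OF y(1)] unfolding prefix_eq_iff .
  then obtain i where i: "i < Suc ?e" "x i \<noteq> y i" by blast
  then have "i = ?e" using agree[of i] by (cases "i < ?e") auto
  then have "x ?e \<noteq> y ?e" using i(2) by blast
  then have "(LEAST n. x n \<noteq> y n) = ?e"
  proof (rule Least_equality)
    show "?e \<le> n" if "x n \<noteq> y n" for n using agree[of n] that linorder_not_le by blast
  qed
  moreover have "x \<noteq> y" using x y(1) by auto
  ultimately have "sdist x y = (1/2) ^ ?e" by (simp add: sdist_def)
  moreover have "bdd_below (sdist x ` X)"
    by (rule bdd_belowI[of _ 0]) (auto simp: sdist_def)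
  ultimately have "setdist x X \<le> (1/2) ^ ?e"
    unfolding setdist_def using cINF_lower[of "sdist x" X y] y(1) by simp
  moreover have "(1/2) ^ ?e \<le> setdist x X"
    unfolding setdist_def
  proof (rule cINF_greatest)
    show "X \<noteq> {}" using y(1) by auto
    show "(1/2) ^ ?e \<le> sdist x y" if "y \<in> X" for y
      using diff[OF that] sdist_less_iff[of x y ?e] by linarith
  qed
  ultimately show ?thesis by simp
qed

lemma pot_eq: "pot a X x = (if x \<in> X then 0 else - a (exit x))"
proof (cases "x \<in> X")
  case False
  have "(THE j. setdist x X = (1/2) ^ j) = exit x"
  proof (rule the_equality)
    show "setdist x X = (1/2) ^ exit x" by (rule setdist_eq[OF False])
    show "j = exit x" if "setdist x X = (1/2) ^ j" for j
      using that power_strict_decreasing[of j "exit x" "1/2 :: real"]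
        power_strict_decreasing[of "exit x" j "1/2 :: real"] setdist_eq[OF False]
      by (cases j "exit x" rule: linorder_cases) auto
  qed
  then show ?thesis using False by (simp add: pot_def)
qed (simp add: pot_def)

lemma clopen_lang: "{x. prefix m x \<in> lang m X} \<in> clopens"
  unfolding clopens_def using depends_prefix by blast

lemma X_sets: "X \<in> sets SM"
proof -
  have "X = (\<Inter>m. {x. prefix m x \<in> lang m X})" using in_iff_prefix by auto
  also have "\<dots> \<in> sets SM" by (intro sets.countable_INT) (auto intro!: clopen_sets clopen_lang)
  finally show ?thesis .
qed

lemma pot_measurable: "pot a X \<in> borel_measurable SM"
proof -
  have "exit \<in> measurable SM (count_space UNIV)"
    unfolding exit_def
  proof (rule measurable_Least)
    fix i
    have "{x. prefix (Suc i) x \<in> lang (Suc i) X} \<in> sets SM"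
      by (rule clopen_sets[OF clopen_lang])
    from sets.compl_sets[OF this]
    show "(\<lambda>x. prefix (Suc i) x \<notin> lang (Suc i) X) \<in> measurable SM (count_space UNIV)"
      unfolding pred_def by (simp add: set_diff_eq)
  qed
  then have "(\<lambda>x. - a (exit x)) \<in> borel_measurable SM"
    by (rule measurable_compose) simp
  then show ?thesis
    unfolding pot_eq[abs_def] using X_sets by (intro measurable_If_set) auto
qed

end

section \<open>From the partition function to the pressure\<close>

lemma suffix_sum_eq: "suffix_sum p w = (\<Sum>i<length w. p (drop i w))"
  by (induction w) (simp_all add: sum.lessThan_Suc_shift del: sum.lessThan_Suc)

text \<open>The finite variational principle, that is, nonnegativity of the relative entropy of
  \<open>p\<close> with respect to the Gibbs weights.\<close>

lemma Gibbs_inequality: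
  fixes p c :: "'b \<Rightarrow> real"
  assumes "finite W" "\<And>w. w \<in> W \<Longrightarrow> 0 \<le> p w" "(\<Sum>w\<in>W. p w) = 1"
  shows "(\<Sum>w\<in>W. eta (p w)) - (\<Sum>w\<in>W. p w * c w) \<le> ln (\<Sum>w\<in>W. exp (- c w))"
proof -
  let ?z = "\<Sum>w\<in>W. exp (- c w)"
  have "W \<noteq> {}" using assms(3) by auto
  then have z: "0 < ?z" using assms(1) by (intro sum_pos) auto
  have "eta (p w) - p w * c w - p w * ln ?z \<le> exp (- c w) / ?z - p w" if w: "w \<in> W" for w
  proof (cases "p w = 0")
    case True
    then show ?thesis using z by simp
  next
    case False
    then have p: "0 < p w" using assms(2)[OF w] by simp
    \<comment> \<open>Ratio of the normalized Gibbs weight to \<open>p w\<close>; the bound of ln t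
      by t - 1, summed against \<open>p\<close>, leaves 1 - 1 = 0.\<close>
    let ?t = "exp (- c w) / (?z * p w)"
    have t: "0 < ?t" using z p by simp
    have "ln ?t = - c w - (ln ?z + ln (p w))"
      using z p by (simp add: ln_div ln_mult_pos)
    moreover have "p w * ln ?t \<le> p w * (?t - 1)"
      using p ln_le_minus_one[OF t] by (intro mult_left_mono) auto
    moreover have "p w * ?t = exp (- c w) / ?z" using p by simp
    ultimately have "p w * (- c w - (ln ?z + ln (p w))) \<le> exp (- c w) / ?z - p w"
      by (simp add: right_diff_distrib)
    then show ?thesis by (simp add: eta_def algebra_simps)
  qed
  then have "(\<Sum>w\<in>W. eta (p w) - p w * c w - p w * ln ?z) \<le> (\<Sum>w\<in>W. exp (- c w) / ?z - p w)"
    by (rule sum_mono)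
  also have "\<dots> = 0" using z assms(3) by (simp add: sum_subtractf sum_divide_distrib[symmetric])
  finally show ?thesis using assms(3) by (simp add: sum_subtractf sum_distrib_right[symmetric])
qed

context shift_prob
begin

lemma integral_prefix:
  fixes c :: "_ \<Rightarrow> real"
  shows "integrable M (\<lambda>x. c (prefix n x))"
    and "(\<integral>x. c (prefix n x) \<partial>M) = (\<Sum>w\<in>words n. measure M (prefix n -` {w}) * c w)"
proof -
  have m: "prefix n -` {w} \<in> sets M" for w :: "'a list"
    using prefix_set[of n w] by (simp add: sets_M vimage_def)
  have eq: "c (prefix n x) = (\<Sum>w\<in>words n. indicator (prefix n -` {w}) x * c w)" for x
  proof -
    have "(\<Sum>w\<in>words n. indicator (prefix n -` {w}) x * c w) = (\<Sum>w\<in>words n. if w = prefix n x then c w else 0)"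
      by (rule sum.cong) (auto simp: indicator_def)
    then show ?thesis by simp
  qed
  have int: "integrable M (\<lambda>x. indicator (prefix n -` {w}) x * c w)" for w
    using m[of w] by (intro integrable_mult_left integrable_real_indicator) (auto simp: emeasure_eq_measure)
  show "integrable M (\<lambda>x. c (prefix n x))"
    unfolding eq by (intro Bochner_Integration.integrable_sum int)
  show "(\<integral>x. c (prefix n x) \<partial>M) = (\<Sum>w\<in>words n. measure M (prefix n -` {w}) * c w)"
    unfolding eq using int m by (subst Bochner_Integration.integral_sum) auto
qed

lemma ent_prefix: "ent M (prefix n) = (\<Sum>w\<in>words n. eta (measure M (prefix n -` {w})))"
  by (subst ent_superset[of "words n"]) auto

lemma sum_prefix: "(\<Sum>w\<in>words n. measure M (prefix n -` {w})) = 1"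
  using integral_prefix(2)[of "\<lambda>_. 1" n] prob_space by simp

end

context shift_inv
begin

lemma distr_shift: "distr M SM (shift ^^ k) = M"
proof -
  have ms: "shift ^^ k \<in> measurable M SM"
    using shift_pow_measurable measurable_cong_sets[OF sets_M refl] by blast
  show ?thesis
  proof (rule measure_eqI)
    fix A assume "A \<in> sets (distr M SM (shift ^^ k))"
    then have A: "A \<in> sets SM" by simp
    then show "emeasure (distr M SM (shift ^^ k)) A = emeasure M A"
      using emeasure_distr[OF ms A] invariant_pow[OF A, of k] by (simp add: emeasure_eq_measure vimage_def)
  qed (simp add: sets_M)
qed

lemma integral_shift:
  fixes f :: "_ \<Rightarrow> real"
  assumes "f \<in> borel_measurable SM"
  shows "(\<integral>x. f ((shift ^^ k) x) \<partial>M) = (\<integral>x. f x \<partial>M)"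
proof -
  have ms: "shift ^^ k \<in> measurable M SM"
    using shift_pow_measurable measurable_cong_sets[OF sets_M refl] by blast
  show ?thesis using integral_distr[OF ms assms] by (simp add: distr_shift)
qed

end

context freezing
begin

lemma pot_bounds: "- a 0 \<le> pot a X x" "pot a X x \<le> 0"
  using a_pos dec by (auto simp: pot_eq less_imp_le decseq_def)

text \<open>If the prefix already leaves the language, the point leaves it no later than the prefix
  shows, and \<open>a\<close> is decreasing. If it does not, the penalty is 0 and the potential is
  nonpositive anyway.\<close>

lemma pot_le_pen: "pot a X x \<le> - pen a (prefix n x)"
proof (cases "prefix n x \<in> language")
  case True
  then show ?thesis using pot_bounds(2) by (simp add: pen_def)
next
  case False
  then have x: "x \<notin> X" using in_iff_prefix[of x] by (auto simp: language_iff)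
  let ?P = "\<lambda>j. take (Suc j) (prefix n x) \<notin> language"
  have exit_lt: "exit x \<le> j" if "prefix (Suc j) x \<notin> language" for j
    using that unfolding exit_def by (intro Least_le) (simp add: language_iff)
  have "exit x \<le> j" if "?P j" for j
  proof (cases "Suc j \<le> n")
    case True
    then show ?thesis using that by (intro exit_lt) (simp add: take_prefix)
  next
    \<comment> \<open>Beyond the end, \<open>take\<close> returns the entire prefix, so the exit
      happened at the last letter at the latest.\<close>
    case j: False
    obtain k where k: "n = Suc k" using False by (cases n) (auto simp: prefix_def)
    then show ?thesis using exit_lt[of k] False j by simp
  qed
  moreover have "?P (LEAST j. ?P j)" by (rule LeastI[of ?P n]) (use False in simp)
  ultimately have "a (LEAST j. ?P j) \<le> a (exit x)" using dec by (auto simp: decseq_def)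
  then show ?thesis using False x by (simp add: pen_def pot_eq)
qed

lemma sum_pot_le: "(\<Sum>i<n. pot a X ((shift ^^ i) x)) \<le> - suffix_sum (pen a) (prefix n x)"
  unfolding suffix_sum_eq sum_negf[symmetric] length_prefix
  by (rule sum_mono) (simp only: drop_prefix pot_le_pen)

lemma pot_integrable:
  assumes "shift_prob M"
  shows "integrable M (pot a X)"
proof -
  interpret shift_prob M by fact
  have "pot a X \<in> borel_measurable M"
    using pot_measurable measurable_cong_sets[OF sets_M refl] by blast
  then show ?thesis
    using pot_bounds by (intro integrable_const_bound[of _ "a 0"]) (auto simp: abs_le_iff minus_le_iff intro!: AE_I2 order_trans[OF pot_bounds(2) less_imp_le[OF a_pos]])
qed

text \<open>By invariance, \<open>n\<close> times the integral of the potential is the integral of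
  its Birkhoff sum, which is dominated by the penalty of the first \<open>n\<close> letters. Gibbs'
  inequality for words of length \<open>n\<close> then brings in \<open>Z\<close>.\<close>

lemma word_pressure_le:
  assumes "shift_inv M"
  shows "ent M (prefix n) + b0 * (real n * integral\<^sup>L M (pot a X)) \<le> ln (Z a b0 n)"
proof -
  interpret shift_inv M by fact
  let ?p = "\<lambda>w. measure M (prefix n -` {w})"
  have int: "integrable M (\<lambda>x. pot a X ((shift ^^ i) x))" for i
  proof -
    have ms: "shift ^^ i \<in> measurable M SM"
      using shift_pow_measurable measurable_cong_sets[OF sets_M refl] by blast
    show ?thesis
      using integrable_distr[OF ms, of "pot a X"] pot_integrable[OF shift_prob_axioms] by (simp add: distr_shift)
  qed
  have "real n * integral\<^sup>L M (pot a X) = (\<Sum>i<n. \<integral>x. pot a X ((shift ^^ i) x) \<partial>M)"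
    by (simp only: integral_shift[OF pot_measurable]) simp
  also have "\<dots> = (\<integral>x. (\<Sum>i<n. pot a X ((shift ^^ i) x)) \<partial>M)"
    by (rule Bochner_Integration.integral_sum[symmetric]) (rule int)
  also have "\<dots> \<le> (\<integral>x. - suffix_sum (pen a) (prefix n x) \<partial>M)"
    by (intro integral_mono Bochner_Integration.integrable_sum int sum_pot_le
        Bochner_Integration.integrable_minus integral_prefix(1)[of "suffix_sum (pen a)"])
  also have "\<dots> = - (\<Sum>w\<in>words n. ?p w * suffix_sum (pen a) w)"
    using integral_prefix(2)[of "suffix_sum (pen a)" n] by simp
  finally have "b0 * (real n * integral\<^sup>L M (pot a X)) \<le> b0 * - (\<Sum>w\<in>words n. ?p w * suffix_sum (pen a) w)"
    using b0_ge_1 by (intro mult_left_mono) auto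
  also have "\<dots> = - (\<Sum>w\<in>words n. ?p w * (b0 * suffix_sum (pen a) w))"
    by (simp add: sum_distrib_left mult_ac)
  finally show ?thesis
    using Gibbs_inequality[of "words n" ?p "\<lambda>w. b0 * suffix_sum (pen a) w"] sum_prefix[of n]
    by (simp add: ent_prefix Z_def)
qed

theorem pressure_le:
  assumes "shift_inv M"
  shows "ks_entropy M + b0 * integral\<^sup>L M (pot a X) \<le> htop X"
proof (rule field_le_epsilon)
  interpret shift_inv M by fact
  fix e :: real assume e: "e > 0"
  define h where "h = htop X + e"
  obtain K where K: "K \<ge> 1" "\<And>n. real (card (lang n X)) \<le> K * exp (h * real n)"
    using card_lang_le_exp[OF e] unfolding h_def by blast
  define c where "c = ln K"
  \<comment> \<open>The factor \<open>K powr (log 2 (real n + 1) + 1)\<close> has a logarithm of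
    order log n, which disappears on division by n.\<close>
  have "(\<lambda>n. (ln 2 + (log 2 (real n + 1) + 1) * c) / real n + h) \<longlonglongrightarrow> h" by real_asymp
  moreover have "ks_entropy M + b0 * integral\<^sup>L M (pot a X) \<le> (ln 2 + (log 2 (real n + 1) + 1) * c) / real n + h"
    if n: "n \<ge> 1" for n
  proof -
    let ?D = "K powr (log 2 (real n + 1) + 1)"
    have Zpos: "0 < Z a b0 n"
      unfolding Z_def
    proof (rule sum_pos)
      show "words n \<noteq> ({} :: 'a list set)" using prefix_in_words[of n undefined] by blast
    qed auto
    have "real n * (ks_entropy M + b0 * integral\<^sup>L M (pot a X)) \<le> ent M (prefix n) + b0 * (real n * integral\<^sup>L M (pot a X))"
      using ks_entropy_le[OF n] n by (simp add: field_simps)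
    also have "\<dots> \<le> ln (Z a b0 n)" by (rule word_pressure_le[OF assms])
    also have "\<dots> \<le> ln (2 * ?D * exp (h * real n))"
      using Z_le[OF K, of n] Zpos e by (intro ln_mono) (auto simp: h_def)
    also have "\<dots> = ln 2 + (log 2 (real n + 1) + 1) * c + h * real n"
      using K(1) by (simp add: ln_mult_pos ln_powr c_def)
    finally show ?thesis using n by (simp add: field_simps)
  qed
  ultimately show "ks_entropy M + b0 * integral\<^sup>L M (pot a X) \<le> htop X + e"
    unfolding h_def[symmetric] by (intro LIMSEQ_le_const) auto
qed

end

section \<open>Existence of a measure of maximal entropy\<close>

lemma prefix_Suc: "prefix (Suc k) x = prefix k x @ [x k]"
  by (simp add: prefix_def)

text \<open>Koenig's lemma: a word that infinitely many of the points start with has, over a finite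
  alphabet, a one-letter extension with the same property.\<close>

lemma infinite_branch:
  fixes y :: "nat \<Rightarrow> nat \<Rightarrow> 'a::finite"
  shows "\<exists>x. \<forall>k. infinite {n. prefix k (y n) = prefix k x}"
proof -
  let ?I = "\<lambda>w. {n. prefix (length w) (y n) = w}"
  have "\<exists>f. \<forall>k. (length (f k) = k \<and> infinite (?I (f k))) \<and> take k (f (Suc k)) = f k"
  proof (rule dependent_nat_choice)
    show "\<exists>w. length w = 0 \<and> infinite (?I w)" by (intro exI[of _ "[]"]) (simp add: prefix_def)
    fix w :: "'a list" and k assume w: "length w = k \<and> infinite (?I w)"
    have "?I w \<subseteq> (\<Union>c. ?I (w @ [c]))"
      by (auto simp: prefix_Suc)
    moreover have "infinite (?I w)" using w by blast
    ultimately have "infinite (\<Union>c. ?I (w @ [c]))" by (rule infinite_super)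
    then obtain c where "infinite (?I (w @ [c]))" by auto
    then show "\<exists>v. (length v = Suc k \<and> infinite (?I v)) \<and> take k v = w"
      using w by (intro exI[of _ "w @ [c]"] conjI) simp_all
  qed
  then obtain f where f: "\<And>k. length (f k) = k" "\<And>k. infinite (?I (f k))" "\<And>k. take k (f (Suc k)) = f k"
    by blast
  define x where "x i = f (Suc i) ! i" for i
  have "prefix k x = f k" for k
  proof (induction k)
    case 0
    then show ?case using f(1)[of 0] by (simp add: prefix_def)
  next
    case (Suc k)
    have "prefix (Suc k) x = prefix k x @ [x k]" by (rule prefix_Suc)
    also have "\<dots> = take k (f (Suc k)) @ [f (Suc k) ! k]" by (simp only: Suc f(3)) (simp add: x_def)
    also have "\<dots> = f (Suc k)" using f(1)[of "Suc k"] by (simp add: take_Suc_conv_app_nth[symmetric])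
    finally show ?case .
  qed
  then have "infinite {n. prefix k (y n) = prefix k x}" for k
    using f(2)[of k] by (simp add: f(1))
  then show ?thesis by blast
qed

lemma clopen_compact:
  fixes A :: "nat \<Rightarrow> (nat \<Rightarrow> 'a::finite) set"
  assumes A: "\<And>i. A i \<in> clopens" and dec: "decseq A" and empty: "(\<Inter>i. A i) = {}"
  shows "\<exists>i. A i = {}"
proof (rule ccontr)
  assume "\<nexists>i. A i = {}"
  then have "\<forall>i. \<exists>x. x \<in> A i" by blast
  then obtain y where y: "\<And>i. y i \<in> A i" by metis
  obtain x where x: "\<And>k. infinite {n. prefix k (y n) = prefix k x}"
    using infinite_branch[of y] by blast
  have "x \<in> A i" for i
  proof -
    obtain m where m: "depends m (A i)" using A[of i] unfolding clopens_def by blast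
    obtain n where n: "n \<ge> i" "prefix m (y n) = prefix m x"
      using x[of m] unfolding infinite_nat_iff_unbounded_le by blast
    have "y n \<in> A i" using y[of n] decseqD[OF dec n(1)] by blast
    then show "x \<in> A i" by (rule dependsD[OF m n(2)])
  qed
  then show False using empty by blast
qed

text \<open>By compactness a decreasing sequence of clopen sets with empty intersection is
  eventually empty, so finite additivity already gives the continuity at the empty set that
  Caratheodory's theorem asks for.\<close>

lemma clopen_measure_extension:
  fixes P :: "(nat \<Rightarrow> 'a::finite) set \<Rightarrow> real"
  assumes nonneg: "\<And>C. C \<in> clopens \<Longrightarrow> 0 \<le> P C"
    and add: "\<And>C D. C \<in> clopens \<Longrightarrow> D \<in> clopens \<Longrightarrow> C \<inter> D = {} \<Longrightarrow> P (C \<union> D) = P C + P D"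
    and one: "P UNIV = 1"
  obtains M where "shift_prob M" "\<And>C. C \<in> clopens \<Longrightarrow> measure M C = P C"
proof -
  have P0: "P {} = 0" using add[of "{}" "{}"] by simp
  have "\<exists>\<mu>. (\<forall>s\<in>clopens. \<mu> s = ennreal (P s)) \<and> measure_space UNIV (sigma_sets UNIV clopens) \<mu>"
  proof (rule clopens.caratheodory_empty_continuous)
    show "positive clopens (\<lambda>s. ennreal (P s))" by (simp add: positive_def P0)
    show "additive clopens (\<lambda>s. ennreal (P s))"
      unfolding additive_def using add nonneg by (simp add: ennreal_plus[symmetric] del: ennreal_plus)
    fix A :: "nat \<Rightarrow> (nat \<Rightarrow> 'a) set"
    assume A: "range A \<subseteq> clopens" "decseq A" "(\<Inter>i. A i) = {}"
    then obtain i where "A i = {}" using clopen_compact[of A] by blast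
    then have "A n = {}" if "n \<ge> i" for n using decseqD[OF A(2) that] by auto
    then have "\<forall>\<^sub>F n in sequentially. 0 = ennreal (P (A n))"
      by (auto simp: eventually_sequentially P0 intro!: exI[of _ i])
    then show "(\<lambda>n. ennreal (P (A n))) \<longlonglongrightarrow> 0" by (rule Lim_transform_eventually[OF tendsto_const])
  qed simp
  then obtain \<mu> where \<mu>: "\<And>C. C \<in> clopens \<Longrightarrow> \<mu> C = ennreal (P C)"
    "measure_space UNIV (sigma_sets UNIV clopens) \<mu>" by blast
  define M where "M = measure_of UNIV clopens \<mu>"
  have sets: "sets M = sets SM" by (simp add: M_def sets_SM)
  have em: "emeasure M C = ennreal (P C)" if "C \<in> clopens" for C
    using \<mu>(1)[OF that] \<mu>(2) clopen_sets[OF that]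
    by (subst emeasure_measure_of[OF M_def]) (auto simp: measure_space_def sets sets_SM)
  have "prob_space M"
    using em[of UNIV] one sets_eq_imp_space_eq[OF sets] by (intro prob_spaceI) simp
  then have "shift_prob M" by (simp add: shift_prob_def shift_prob_axioms_def sets)
  moreover have "measure M C = P C" if "C \<in> clopens" for C
    using em[OF that] nonneg[OF that] by (simp add: measure_def)
  ultimately show thesis by (rule that)
qed

lemma vimage_shift_clopen: "C \<in> clopens \<Longrightarrow> (shift ^^ k) -` C \<in> clopens"
proof -
  assume "C \<in> clopens"
  then obtain n where n: "depends n C" unfolding clopens_def by blast
  have "depends (k + n) ((shift ^^ k) -` C)"
  proof (rule dependsI)
    fix x y :: "nat \<Rightarrow> 'a"
    assume "prefix (k + n) x = prefix (k + n) y" "x \<in> (shift ^^ k) -` C"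
    moreover from this have "prefix n ((shift ^^ k) x) = prefix n ((shift ^^ k) y)"
      unfolding prefix_add by simp
    ultimately show "y \<in> (shift ^^ k) -` C" using dependsD[OF n] by blast
  qed
  then show ?thesis unfolding clopens_def by blast
qed

lemma shift_invI:
  assumes "shift_prob M" and C: "\<And>C. C \<in> clopens \<Longrightarrow> measure M (shift -` C) = measure M C"
  shows "shift_inv M"
proof -
  interpret shift_prob M by fact
  have ms: "shift \<in> measurable M SM"
    using shift_measurable measurable_cong_sets[OF sets_M refl] by blast
  have eq: "distr M SM shift = M"
  proof (rule shift_prob_eqI)
    show "shift_prob (distr M SM shift)" using shift_prob_distr[OF assms(1), of 1] by simp
    show "measure (distr M SM shift) D = measure M D" if "D \<in> clopens" for D
      using measure_distr[OF ms clopen_sets[OF that]] C[OF that] by (simp only: space_M Int_UNIV_right)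
  qed fact
  show ?thesis
  proof
    show "emeasure M (shift -` A) = emeasure M A" if "A \<in> sets SM" for A
      using emeasure_distr[OF ms that] by (simp add: eq)
  qed
qed

lemma (in ssubshift) measure_X_eq_1:
  assumes "shift_prob M" and "\<And>m. measure M {x. prefix m x \<in> lang m X} = 1"
  shows "measure M X = 1"
proof -
  interpret shift_prob M by fact
  have "AE x in M. prefix m x \<in> lang m X" for m
    using AE_prob_1[of "{x. prefix m x \<in> lang m X}"] assms(2) by simp
  then have "AE x in M. \<forall>m. prefix m x \<in> lang m X" by (simp add: AE_all_countable)
  then have "AE x in M. x \<in> X" using in_iff_prefix by simp
  then show ?thesis
    using prob_eq_1[of X] X_sets by (simp add: sets_M)
qed

text \<open>At 0 the logarithm has no limit, so continuity of \<open>eta\<close> there rests on its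
  smallness near 0 instead of the product rule.\<close>

lemma tendsto_eta:
  assumes f: "(f \<longlongrightarrow> p) F" and nonneg: "\<And>x. 0 \<le> f x" and p: "0 \<le> p"
  shows "((\<lambda>x. eta (f x)) \<longlongrightarrow> eta p) F"
proof (cases "p = 0")
  case True
  show ?thesis
  proof (rule tendstoI)
    fix e :: real assume e: "e > 0"
    have "e / 2 > 0" using e by simp
    then obtain d where d: "d > 0" "\<And>p. 0 \<le> p \<Longrightarrow> p \<le> d \<Longrightarrow> eta p \<le> e / 2"
      by (rule eta_small) blast
    have "\<forall>\<^sub>F x in F. f x < min d 1" using f True d(1) by (intro order_tendstoD(2)) auto
    then show "\<forall>\<^sub>F x in F. dist (eta (f x)) (eta p) < e"
    proof eventually_elim
      case (elim x)
      then have "eta (f x) \<le> e / 2" "0 \<le> eta (f x)" using d(2)[of "f x"] nonneg[of x] eta_nonneg[of "f x"] by auto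
      then show ?case using e True by (simp add: dist_real_def)
    qed
  qed
next
  case False
  then show ?thesis unfolding eta_def by (intro tendsto_intros f)
qed

text \<open>Concavity of \<open>eta\<close>, through its tangent at the mean \<open>r\<close>: the
  deviations from the mean sum to zero. A zero mean forces all values to vanish.\<close>

lemma eta_average:
  fixes q :: "nat \<Rightarrow> real"
  assumes q: "\<And>k. 0 \<le> q k" and N: "N \<ge> 1"
  shows "(\<Sum>k<N. eta (q k)) \<le> real N * eta ((\<Sum>k<N. q k) / real N)"
proof -
  define r where "r = (\<Sum>k<N. q k) / real N"
  have r: "0 \<le> r" "(\<Sum>k<N. q k) = real N * r" using N q by (auto simp: r_def intro!: divide_nonneg_nonneg sum_nonneg)
  show ?thesis
  proof (cases "r = 0")
    case True
    then have "(\<Sum>k<N. q k) = 0" using r(2) by simp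
    then have "\<forall>k<N. q k = 0" using q by (subst (asm) sum_nonneg_eq_0_iff) auto
    then show ?thesis using True by (simp add: r_def[symmetric])
  next
    case False
    then have r0: "0 < r" using r(1) by simp
    have "eta (q k) \<le> - q k * ln r + (r - q k)" for k
    proof (cases "q k = 0")
      case False
      then have qk: "0 < q k" using q[of k] by simp
      have "ln (r / q k) \<le> r / q k - 1" using r0 qk by (intro ln_le_minus_one) simp
      then have "q k * ln (r / q k) \<le> q k * (r / q k - 1)" using qk by (intro mult_left_mono) auto
      also have "q k * (r / q k - 1) = r - q k" using qk by (simp add: field_simps)
      finally have "q k * (ln r - ln (q k)) \<le> r - q k" using r0 qk by (simp add: ln_div)
      then show ?thesis by (simp add: eta_def algebra_simps)
    qed (use r0 in simp)
    then have "(\<Sum>k<N. eta (q k)) \<le> (\<Sum>k<N. - q k * ln r + (r - q k))" by (intro sum_mono)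
    also have "\<dots> = - (\<Sum>k<N. q k) * ln r + (real N * r - (\<Sum>k<N. q k))"
      by (simp add: sum.distrib sum_subtractf sum_distrib_right sum_negf)
    also have "\<dots> = real N * eta r" unfolding r(2) by (simp add: eta_def)
    finally show ?thesis by (simp add: r_def)
  qed
qed

text \<open>Misiurewicz's averaging: cut a long window into consecutive windows of length \<open>m\<close>, starting at
  each of the \<open>m\<close> residues, and add up.\<close>

lemma window_average:
  fixes E :: "nat \<Rightarrow> nat \<Rightarrow> real"
  assumes sub: "\<And>k m n. E k (m + n) \<le> E k m + E (k + m) n"
    and bound: "\<And>k m. E k m \<le> real m * L" and L: "0 \<le> L"
    and mono: "\<And>n n'. n \<le> n' \<Longrightarrow> E 0 n \<le> E 0 n'"
    and m: "m \<ge> 1"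
  shows "real m * E 0 N \<le> (\<Sum>k<N. E k m) + 2 * real m ^ 2 * L"
proof -
  \<comment> \<open>From any starting residue, \<open>q\<close> windows of length \<open>m\<close>
    reach at least position \<open>N\<close>, while \<open>q * m\<close> exceeds \<open>N\<close> by
    at most \<open>m\<close>.\<close>
  define q where "q = N div m + 1"
  have dm: "N div m * m + N mod m = N" "N mod m < m" using m by simp_all
  have qm: "q * m = N div m * m + m" by (simp add: q_def)
  have q1: "N \<le> q * m" and q2: "q * m \<le> N + m" using dm unfolding qm by linarith+
  have chain: "E 0 (r + q * m) \<le> E 0 r + (\<Sum>j<q. E (r + j * m) m)" for r q
  proof (induction q)
    case (Suc q)
    have "E 0 (r + Suc q * m) = E 0 ((r + q * m) + m)" by (simp add: algebra_simps)
    also have "\<dots> \<le> E 0 (r + q * m) + E (r + q * m) m" using sub[of 0 "r + q * m" m] by simp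
    finally show ?case using Suc by simp
  qed simp
  have "E 0 N \<le> real m * L + (\<Sum>j<q. E (r + j * m) m)" if "r < m" for r
  proof -
    have "E 0 N \<le> E 0 (r + q * m)" using q1 by (intro mono) simp
    also have "\<dots> \<le> E 0 r + (\<Sum>j<q. E (r + j * m) m)" by (rule chain)
    also have "E 0 r \<le> real r * L" by (rule bound)
    also have "\<dots> \<le> real m * L" using that L by (intro mult_right_mono) auto
    finally show ?thesis by simp
  qed
  then have "(\<Sum>r<m. E 0 N) \<le> (\<Sum>r<m. real m * L + (\<Sum>j<q. E (r + j * m) m))"
    by (intro sum_mono) auto
  also have "\<dots> = real m ^ 2 * L + (\<Sum>j<q. \<Sum>r<m. E (r + j * m) m)"
    by (subst sum.swap) (simp add: sum.distrib power2_eq_square)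
  also have "(\<Sum>j<q. \<Sum>r<m. E (r + j * m) m) = (\<Sum>j<q. \<Sum>k\<in>{j * m..<j * m + m}. E k m)"
  proof (rule sum.cong[OF refl])
    fix j
    show "(\<Sum>r<m. E (r + j * m) m) = (\<Sum>k\<in>{j * m..<j * m + m}. E k m)"
      by (rule sum.reindex_bij_witness[of _ "\<lambda>k. k - j * m" "\<lambda>r. r + j * m"]) auto
  qed
  also have "\<dots> = (\<Sum>k<q * m. E k m)" by (rule sum.nat_group)
  also have "\<dots> = (\<Sum>k<N. E k m) + (\<Sum>k\<in>{N..<q * m}. E k m)"
    using q1 by (subst sum.union_disjoint[symmetric]) (auto intro: sum.cong)
  \<comment> \<open>Over all residues each \<open>k\<close> below \<open>q * m\<close> starts
    exactly one window. The at most \<open>m\<close> windows starting past \<open>N\<close> cost one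
    \<open>m ^ 2 * L\<close>; the pieces before the first windows have cost the other.\<close>
  also have "(\<Sum>k\<in>{N..<q * m}. E k m) \<le> (\<Sum>k\<in>{N..<q * m}. real m * L)" by (intro sum_mono bound)
  also have "\<dots> = real (q * m - N) * (real m * L)" by simp
  also have "\<dots> \<le> real m * (real m * L)" using q2 L by (intro mult_right_mono) auto
  finally show ?thesis by (simp add: power2_eq_square algebra_simps)
qed

text \<open>Tychonoff's theorem in place of a diagonal argument. Countability of the index type
  makes the product metrizable, so that compactness yields a convergent subsequence.\<close>

lemma bounded_family_subseq:
  fixes p :: "nat \<Rightarrow> 'b::countable \<Rightarrow> real"
  assumes "\<And>n w. p n w \<in> {0..1}"
  obtains r l where "strict_mono (r :: nat \<Rightarrow> nat)" "\<And>w. (\<lambda>n. p (r n) w) \<longlonglongrightarrow> l w"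
proof -
  have "compactin (product_topology (\<lambda>_. euclidean) UNIV) (PiE UNIV (\<lambda>_ :: 'b. {0..1 :: real}))"
    by (subst compactin_PiE) auto
  then have "compact (PiE UNIV (\<lambda>_ :: 'b. {0..1 :: real}))"
    by (simp add: euclidean_product_topology)
  then have "seq_compact (PiE UNIV (\<lambda>_ :: 'b. {0..1 :: real}))"
    by (simp add: compact_eq_seq_compact_metric)
  then obtain l r where l: "strict_mono (r :: nat \<Rightarrow> nat)" "(p \<circ> r) \<longlonglongrightarrow> l"
    using assms unfolding seq_compact_def by (metis PiE_UNIV_domain Pi_I)
  have "(\<lambda>n. p (r n) w) \<longlonglongrightarrow> l w" for w
  proof -
    have "isCont (\<lambda>f :: 'b \<Rightarrow> real. f w) l"
    proof -
      have "continuous_on UNIV (\<lambda>f :: 'b \<Rightarrow> real. f w)" by simp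
      then show ?thesis unfolding continuous_on_eq_continuous_at[OF open_UNIV] by blast
    qed
    from isCont_tendsto_compose[OF this l(2)] show ?thesis by simp
  qed
  then show thesis using l(1) by (intro that)
qed

section \<open>Empirical measures of a subshift and their limits\<close>

context ssubshift
begin

text \<open>The uniform distribution on words of length \<open>N\<close> has entropy
  \<open>ln (card (lang N X))\<close>, which is averaged over windows. Words are replaced by points
  extending them so that windows near the right end keep their full length.\<close>

lemma window_bound:
  assumes m: "m \<ge> 1" and rep: "\<And>w. w \<in> lang N X \<Longrightarrow> prefix N (rep w) = w"
  shows "real m * ln (real (card (lang N X)))
    \<le> (\<Sum>k<N. \<Sum>v\<in>words m. eta (measure (measure_pmf (pmf_of_set (lang N X))) {w. prefix m ((shift ^^ k) (rep w)) = v}))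
      + 2 * real m ^ 2 * ln (real CARD('a))"
proof -
  let ?M = "measure_pmf (pmf_of_set (lang N X))"
  define E where "E k n = ent ?M (\<lambda>w. prefix n ((shift ^^ k) (rep w)))" for k n
  have simple: "simple_function ?M (\<lambda>w. prefix n ((shift ^^ k) (rep w)))" for k n
    unfolding simple_function_def
  proof (intro conjI ballI)
    show "finite ((\<lambda>w. prefix n ((shift ^^ k) (rep w))) ` space ?M)"
      by (rule finite_subset[of _ "words n"]) auto
  qed simp
  have E_sum: "E k n = (\<Sum>v\<in>words n. eta (measure ?M {w. prefix n ((shift ^^ k) (rep w)) = v}))" for k n
    unfolding E_def by (subst ent_superset[of "words n"]) (auto simp: vimage_def)
  have "ln (real (card (lang N X))) \<le> E 0 N"
  proof -
    let ?c = "real (card (lang N X))"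
    have c: "?c \<ge> 1" using card_lang_ge_1[of N] by simp
    have "measure ?M {w. prefix N (rep w) = v} = 1 / ?c" if "v \<in> lang N X" for v
    proof -
      have "lang N X \<inter> {w. prefix N (rep w) = v} = {v}" using rep that by auto
      then show ?thesis by (subst measure_pmf_of_set[OF lang_nonempty finite_lang]) simp
    qed
    then have "(\<Sum>v\<in>lang N X. eta (measure ?M {w. prefix N (rep w) = v})) = ln ?c"
      using c by (simp add: eta_def ln_div)
    moreover have "(\<Sum>v\<in>lang N X. eta (measure ?M {w. prefix N (rep w) = v})) \<le> E 0 N"
      unfolding E_sum by (simp only: funpow_0, rule sum_mono2) (auto intro!: lang_subset_words eta_nonneg)
    ultimately show ?thesis by simp
  qed
  then have "real m * ln (real (card (lang N X))) \<le> real m * E 0 N"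
    by (rule mult_left_mono) simp
  also have "\<dots> \<le> (\<Sum>k<N. E k m) + 2 * real m ^ 2 * ln (real CARD('a))"
  proof (rule window_average[OF _ _ _ _ m])
    fix k i n
    have "prefix (i + n) ((shift ^^ k) x) = prefix i ((shift ^^ k) x) @ prefix n ((shift ^^ (k + i)) x)" for x :: "nat \<Rightarrow> 'a"
      by (simp only: prefix_add add.commute[of k i] funpow_add o_apply)
    then have "E k (i + n) \<le> ent ?M (\<lambda>w. (prefix i ((shift ^^ k) (rep w)), prefix n ((shift ^^ (k + i)) (rep w))))"
      unfolding E_def
      by (intro measure_pmf.ent_factor[of _ _ _ "\<lambda>(u, v). u @ v"] simple_function_Pair simple) (simp only: split_conv)
    also have "\<dots> \<le> E k i + E (k + i) n"
      unfolding E_def by (intro measure_pmf.ent_Pair simple)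
    finally show "E k (i + n) \<le> E k i + E (k + i) n" .
  next
    fix k n
    have "E k n \<le> ln (real (card ((\<lambda>w. prefix n ((shift ^^ k) (rep w))) ` space ?M)))"
      unfolding E_def by (rule measure_pmf.ent_le_ln_card[OF simple])
    also have "\<dots> \<le> ln (real (card (words n :: 'a list set)))"
    proof (rule ln_mono)
      have "card ((\<lambda>w. prefix n ((shift ^^ k) (rep w))) ` space ?M) \<le> card (words n :: 'a list set)"
        by (rule card_mono) auto
      then show "real (card ((\<lambda>w. prefix n ((shift ^^ k) (rep w))) ` space ?M)) \<le> real (card (words n :: 'a list set))"
        by (rule of_nat_mono)
      have "finite ((\<lambda>w. prefix n ((shift ^^ k) (rep w))) ` space ?M)"
        by (rule simple_functionD(1)[OF simple])
      then show "0 < real (card ((\<lambda>w. prefix n ((shift ^^ k) (rep w))) ` space ?M))"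
        by (simp add: card_gt_0_iff)
    qed
    also have "\<dots> = real n * ln (real CARD('a))" by (simp add: card_words ln_realpow)
    finally show "E k n \<le> real n * ln (real CARD('a))" .
  next
    fix n n' :: nat assume "n \<le> n'"
    then show "E 0 n \<le> E 0 n'"
      unfolding E_def by (intro measure_pmf.ent_factor[of _ _ _ "take n"] simple) (simp only: take_prefix)
  qed simp
  finally show ?thesis unfolding E_sum .
qed

text \<open>Uniform distributions on words of length N, carried to points of X and averaged along
  the first N shifts, accumulate at an invariant measure. Averaging over windows transfers the
  growth of the language to the block entropies of the limit.\<close>

theorem max_entropy_measure: "\<exists>M. shift_inv M \<and> measure M X = 1 \<and> htop X \<le> ks_entropy M"
proof -
  have "\<forall>N w. \<exists>x. w \<in> lang N X \<longrightarrow> x \<in> X \<and> prefix N x = w" by (auto simp: lang_eq)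
  then obtain rep where rep: "\<And>N w. w \<in> lang N X \<Longrightarrow> rep N w \<in> X" "\<And>N w. w \<in> lang N X \<Longrightarrow> prefix N (rep N w) = w"
    by metis
  define \<nu> where "\<nu> N = measure_pmf (pmf_of_set (lang N X))" for N
  define q where "q N k C = measure (\<nu> N) {w. (shift ^^ k) (rep N w) \<in> C}" for N k C
  \<comment> \<open>At \<open>N = 0\<close> this is 0 rather than a probability, which is why the
    limits below run over \<open>Suc n\<close>.\<close>
  define p where "p N C = (\<Sum>k<N. q N k C) / real N" for N C
  define cyl where "cyl w = {x :: nat \<Rightarrow> 'a. prefix (length w) x = w}" for w
  have q01: "0 \<le> q N k C" "q N k C \<le> 1" for N k C
    unfolding q_def \<nu>_def by (simp_all add: measure_pmf.prob_le_1)
  have p0: "0 \<le> p N C" for N C unfolding p_def by (intro divide_nonneg_nonneg sum_nonneg q01) simp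
  have p1: "p N C \<le> 1" for N C
  proof -
    have "(\<Sum>k<N. q N k C) \<le> (\<Sum>k<N. 1)" by (intro sum_mono q01)
    then show ?thesis by (cases "N = 0") (simp_all add: p_def)
  qed
  have p_full: "p (Suc n) {x. prefix m x \<in> lang m X} = 1" for n m
  proof -
    have "q (Suc n) k {x. prefix m x \<in> lang m X} = 1" for k
    proof -
      have "w \<in> {w. (shift ^^ k) (rep (Suc n) w) \<in> {x. prefix m x \<in> lang m X}}" if "w \<in> lang (Suc n) X" for w
        using shift_pow_in[OF rep(1)[OF that], of k] lang_eq[of m] by blast
      then have "lang (Suc n) X \<inter> {w. (shift ^^ k) (rep (Suc n) w) \<in> {x. prefix m x \<in> lang m X}} = lang (Suc n) X"
        by blast
      then show ?thesis
        unfolding q_def \<nu>_def using lang_nonempty[of "Suc n"] by (subst measure_pmf_of_set) simp_all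
    qed
    then show ?thesis by (simp add: p_def)
  qed
  have p_UNIV: "p (Suc n) UNIV = 1" for n
    by (simp add: p_def q_def \<nu>_def)
  have p_Un: "p N (C \<union> D) = p N C + p N D" if "C \<inter> D = {}" for N C D
  proof -
    have "q N k (C \<union> D) = q N k C + q N k D" for k
    proof -
      have "{w. (shift ^^ k) (rep N w) \<in> C \<union> D} = {w. (shift ^^ k) (rep N w) \<in> C} \<union> {w. (shift ^^ k) (rep N w) \<in> D}"
        by blast
      then show ?thesis unfolding q_def \<nu>_def
        using that by (simp only:, intro measure_pmf.finite_measure_Union) auto
    qed
    then show ?thesis by (simp add: p_def sum.distrib add_divide_distrib)
  qed
  have p_fin: "p N (\<Union>w\<in>W. cyl w) = (\<Sum>w\<in>W. p N (cyl w))" if "finite W" "W \<subseteq> words m" for N W m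
    using that
  proof (induction W rule: finite_induct)
    case empty
    then show ?case by (simp add: p_def q_def)
  next
    case (insert w W)
    have "cyl w \<inter> (\<Union>w\<in>W. cyl w) = {}"
      using insert.hyps insert.prems by (auto simp: cyl_def words_def)
    then show ?case using insert by (simp add: p_Un)
  qed
  \<comment> \<open>There are countably many words, so one subsequence serves all cylinders; clopen
    sets, being finite disjoint unions of them, follow.\<close>
  obtain r l where r: "strict_mono (r :: nat \<Rightarrow> nat)" and l: "\<And>w. (\<lambda>n. p (Suc (r n)) (cyl w)) \<longlonglongrightarrow> l w"
    using bounded_family_subseq[of "\<lambda>n w. p (Suc n) (cyl w)"] p0 p1 by auto
  define P where "P C = lim (\<lambda>n. p (Suc (r n)) C)" for C
  have conv: "(\<lambda>n. p (Suc (r n)) C) \<longlonglongrightarrow> P C" if "C \<in> clopens" for C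
  proof -
    obtain m where m: "depends m C" using \<open>C \<in> clopens\<close> unfolding clopens_def by blast
    have W: "prefix m ` C \<subseteq> words m" "finite (prefix m ` C)"
      by (auto intro: finite_subset[of _ "words m"])
    have C: "C = (\<Union>w\<in>prefix m ` C. cyl w)"
      using depends_eq[OF m] by (auto simp: cyl_def)
    have "(\<lambda>n. \<Sum>w\<in>prefix m ` C. p (Suc (r n)) (cyl w)) \<longlonglongrightarrow> (\<Sum>w\<in>prefix m ` C. l w)"
      by (intro tendsto_sum l)
    moreover have "p N C = (\<Sum>w\<in>prefix m ` C. p N (cyl w))" for N
      by (subst C) (rule p_fin[OF W(2,1)])
    ultimately have "(\<lambda>n. p (Suc (r n)) C) \<longlonglongrightarrow> (\<Sum>w\<in>prefix m ` C. l w)" by simp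
    then show ?thesis unfolding P_def by (simp add: limI)
  qed
  obtain M where M: "shift_prob M" and MP: "\<And>C. C \<in> clopens \<Longrightarrow> measure M C = P C"
  proof (rule clopen_measure_extension[of P])
    show "0 \<le> P C" if "C \<in> clopens" for C
      by (rule LIMSEQ_le_const[OF conv[OF that]]) (simp add: p0)
    show "P (C \<union> D) = P C + P D" if "C \<in> clopens" "D \<in> clopens" "C \<inter> D = {}" for C D
    proof (rule LIMSEQ_unique)
      show "(\<lambda>n. p (Suc (r n)) (C \<union> D)) \<longlonglongrightarrow> P (C \<union> D)"
        using that by (intro conv clopens.Un)
      show "(\<lambda>n. p (Suc (r n)) (C \<union> D)) \<longlonglongrightarrow> P C + P D"
        unfolding p_Un[OF that(3)] using that by (intro tendsto_add conv)
    qed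
    show "P UNIV = 1" unfolding P_def p_UNIV by (rule limI[OF tendsto_const])
  qed blast
  have sub0: "(\<lambda>n. c / real (Suc (r n))) \<longlonglongrightarrow> 0" for c
    using LIMSEQ_subseq_LIMSEQ[OF LIMSEQ_Suc[OF lim_const_over_n[of c]] r] by (simp only: o_def)
  have inv: "shift_inv M"
  proof (rule shift_invI[OF M])
    fix C :: "(nat \<Rightarrow> 'a) set" assume C: "C \<in> clopens"
    have sC: "shift -` C \<in> clopens" using vimage_shift_clopen[OF C, of 1] by simp
    have "\<bar>p (Suc n) (shift -` C) - p (Suc n) C\<bar> \<le> 1 / real (Suc n)" for n
    proof -
      have "q (Suc n) k (shift -` C) = q (Suc n) (Suc k) C" for k
        by (simp add: q_def)
      \<comment> \<open>Shifting the set moves the time by one, so the averages telescope to two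
        boundary terms and differ by at most 1/(n+1).\<close>
      then have "(\<Sum>k<Suc n. q (Suc n) k (shift -` C)) - (\<Sum>k<Suc n. q (Suc n) k C) = q (Suc n) (Suc n) C - q (Suc n) 0 C"
        using sum_lessThan_telescope[of "\<lambda>k. q (Suc n) k C" "Suc n"] by (simp only: sum_subtractf[symmetric])
      then have "p (Suc n) (shift -` C) - p (Suc n) C = (q (Suc n) (Suc n) C - q (Suc n) 0 C) / real (Suc n)"
        by (simp only: p_def diff_divide_distrib[symmetric])
      moreover have "\<bar>q (Suc n) (Suc n) C - q (Suc n) 0 C\<bar> \<le> 1"
        using q01[of "Suc n" "Suc n" C] q01[of "Suc n" 0 C] by (simp add: abs_le_iff)
      ultimately show ?thesis by (simp add: abs_divide divide_right_mono)
    qed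
    then have "\<forall>\<^sub>F n in sequentially. norm (p (Suc (r n)) (shift -` C) - p (Suc (r n)) C) \<le> 1 / real (Suc (r n))"
      by (simp del: of_nat_Suc)
    then have "(\<lambda>n. p (Suc (r n)) (shift -` C) - p (Suc (r n)) C) \<longlonglongrightarrow> 0"
      by (rule Lim_null_comparison) (rule sub0)
    moreover have "(\<lambda>n. p (Suc (r n)) (shift -` C) - p (Suc (r n)) C) \<longlonglongrightarrow> P (shift -` C) - P C"
      by (intro tendsto_diff conv C sC)
    ultimately have "P (shift -` C) - P C = 0" using LIMSEQ_unique by blast
    then show "measure M (shift -` C) = measure M C" by (simp add: MP C sC)
  qed
  interpret shift_inv M by fact
  have "measure M X = 1"
  proof (rule measure_X_eq_1[OF M])
    fix m
    have "P {x. prefix m x \<in> lang m X} = 1" unfolding P_def p_full by (rule limI[OF tendsto_const])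
    then show "measure M {x. prefix m x \<in> lang m X} = 1" by (simp add: MP[OF clopen_lang])
  qed
  moreover have "htop X \<le> ks_entropy M"
  proof (rule ks_entropy_ge)
    fix m :: nat assume m: "m \<ge> 1"
    let ?L = "2 * real m ^ 2 * ln (real CARD('a))"
    have cyl: "cyl v = prefix m -` {v}" "cyl v \<in> clopens" if "v \<in> words m" for v
    proof -
      show eq: "cyl v = prefix m -` {v}" using that by (auto simp: cyl_def words_def)
      have "{x. prefix m x \<in> {v}} = prefix m -` {v}" by auto
      then have "depends m (cyl v)" using depends_prefix[of m "{v}"] unfolding eq by simp
      then show "cyl v \<in> clopens" unfolding clopens_def by blast
    qed
    have "(\<lambda>n. \<Sum>v\<in>words m. eta (p (Suc (r n)) (cyl v))) \<longlonglongrightarrow> (\<Sum>v\<in>words m. eta (P (cyl v)))"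
      using cyl(2) by (intro tendsto_sum tendsto_eta conv p0) (auto simp: MP[symmetric])
    also have "(\<Sum>v\<in>words m. eta (P (cyl v))) = ent M (prefix m)"
      unfolding ent_prefix
    proof (rule sum.cong[OF refl])
      show "eta (P (cyl v)) = eta (measure M (prefix m -` {v}))" if "v \<in> words m" for v
        using MP[OF cyl(2)[OF that]] cyl(1)[OF that] by simp
    qed
    finally have lim1: "(\<lambda>n. \<Sum>v\<in>words m. eta (p (Suc (r n)) (cyl v))) \<longlonglongrightarrow> ent M (prefix m)" .
    have "(\<lambda>n. ln (real (card (lang (Suc (r n)) X))) / real (Suc (r n))) \<longlonglongrightarrow> htop X"
      using LIMSEQ_subseq_LIMSEQ[OF LIMSEQ_Suc[OF htop_lim] r] by (simp only: o_def)
    then have lim2: "(\<lambda>n. real m * (ln (real (card (lang (Suc (r n)) X))) / real (Suc (r n))) - ?L / real (Suc (r n))) \<longlonglongrightarrow> real m * htop X - 0"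
      by (intro tendsto_diff tendsto_mult tendsto_const sub0)
    \<comment> \<open>Concavity exchanges the average of the window entropies for the entropy of the
      averaged measure, the object that converges.\<close>
    have "real m * (ln (real (card (lang N X))) / real N) - ?L / real N \<le> (\<Sum>v\<in>words m. eta (p N (cyl v)))"
      if N: "N \<ge> 1" for N
    proof -
      have "real m * ln (real (card (lang N X))) \<le> (\<Sum>k<N. \<Sum>v\<in>words m. eta (q N k (cyl v))) + ?L"
      proof -
        have "q N k (cyl v) = measure (measure_pmf (pmf_of_set (lang N X))) {w. prefix m ((shift ^^ k) (rep N w)) = v}"
          if "v \<in> words m" for k v
          using that by (simp only: q_def \<nu>_def cyl_def words_def mem_Collect_eq)
        then show ?thesis using window_bound[of m N "rep N", OF m rep(2)] by simp
      qed
      also have "(\<Sum>k<N. \<Sum>v\<in>words m. eta (q N k (cyl v))) = (\<Sum>v\<in>words m. \<Sum>k<N. eta (q N k (cyl v)))"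
        by (rule sum.swap)
      also have "\<dots> \<le> (\<Sum>v\<in>words m. real N * eta (p N (cyl v)))"
        unfolding p_def by (intro sum_mono eta_average q01 N)
      also have "\<dots> = real N * (\<Sum>v\<in>words m. eta (p N (cyl v)))" by (simp add: sum_distrib_left)
      finally show ?thesis using N by (simp add: field_simps)
    qed
    note bound = this
    have "real m * htop X - 0 \<le> ent M (prefix m)"
      by (rule LIMSEQ_le[OF lim2 lim1], intro exI[of _ 0] allI impI bound) simp
    then show "htop X * real m \<le> ent M (prefix m)" by (simp add: mult.commute)
  qed
  ultimately show ?thesis using inv by blast
qed

end

section \<open>The freezing transition\<close>

lemma ssubshift_UNIV: "ssubshift (UNIV :: (nat \<Rightarrow> 'a::finite) set)"
  by (simp add: ssubshift_def subshift_def sclosed_def)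

lemma htop_UNIV: "htop (UNIV :: (nat \<Rightarrow> 'a::finite) set) = ln (real CARD('a))"
proof -
  interpret ssubshift "UNIV :: (nat \<Rightarrow> 'a) set" by (rule ssubshift_UNIV)
  have "lang m (UNIV :: (nat \<Rightarrow> 'a) set) = words m" for m
    unfolding lang_eq using prefix_surj by (auto simp: image_def)
  then have "ln (real (card (lang m (UNIV :: (nat \<Rightarrow> 'a) set)))) / real m = ln (real CARD('a))" if "m \<ge> 1" for m
    using that by (simp add: card_words ln_realpow)
  then have "\<forall>\<^sub>F m in sequentially. ln (real (card (lang m (UNIV :: (nat \<Rightarrow> 'a) set)))) / real m = ln (real CARD('a))"
    unfolding eventually_sequentially by blast
  then have "(\<lambda>m. ln (real (card (lang m (UNIV :: (nat \<Rightarrow> 'a) set)))) / real m) \<longlonglongrightarrow> ln (real CARD('a))"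
    by (rule tendsto_eventually)
  then show ?thesis using htop_lim LIMSEQ_unique by blast
qed

text \<open>A single forbidden word suffices: at its length the language is a proper subset of all
  words, and the quotient at any one length bounds the entropy from above.\<close>

lemma (in ssubshift) htop_less:
  assumes "X \<noteq> UNIV"
  shows "htop X < ln (real CARD('a))"
proof -
  obtain x where "x \<notin> X" using assms by auto
  then have "prefix (Suc (exit x)) x \<notin> lang (Suc (exit x)) X" by (rule exit_outside)
  then have "lang (Suc (exit x)) X \<subset> words (Suc (exit x))"
    using lang_subset_words prefix_in_words by blast
  then have "card (lang (Suc (exit x)) X) < card (words (Suc (exit x)) :: 'a list set)"
    by (rule psubset_card_mono[OF finite_words])
  then have "real (card (lang (Suc (exit x)) X)) < real CARD('a) ^ Suc (exit x)"
    unfolding card_words by (metis of_nat_less_iff of_nat_power)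
  then have "ln (real (card (lang (Suc (exit x)) X))) < ln (real CARD('a) ^ Suc (exit x))"
    using card_lang_ge_1[of "Suc (exit x)"] by (subst ln_less_cancel_iff) auto
  also have "\<dots> = real (Suc (exit x)) * ln (real CARD('a))" by (rule ln_realpow)
  finally have "ln (real (card (lang (Suc (exit x)) X))) / real (Suc (exit x)) < ln (real CARD('a))"
    by (simp add: field_simps del: of_nat_Suc)
  then show ?thesis using htop_le[of "Suc (exit x)"] by simp
qed

text \<open>Membership in a clopen set is decided by finitely many letters, so its indicator is an
  admissible test function for vague convergence.\<close>

lemma measure_continuous_vague:
  fixes C :: "(nat \<Rightarrow> 'a::finite) set"
  assumes "vague_limit \<mu> \<nu>" "shift_prob \<nu>" "\<And>n. shift_prob (\<mu> n)" and C: "C \<in> clopens"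
  shows "(\<lambda>n. measure (\<mu> n) C) \<longlonglongrightarrow> measure \<nu> C"
proof -
  obtain m where m: "depends m C" using C unfolding clopens_def by blast
  have "scontinuous (indicator C :: _ \<Rightarrow> real)"
  proof (rule scontinuous_prefix)
    fix x y :: "nat \<Rightarrow> 'a" assume "prefix m x = prefix m y"
    then have "x \<in> C \<longleftrightarrow> y \<in> C" using dependsD[OF m] by metis
    then show "(indicator C x :: real) = indicator C y" by (simp add: indicator_def)
  qed
  moreover have "integral\<^sup>L M (indicator C) = measure M C" if "shift_prob M" for M :: "(nat \<Rightarrow> 'a) measure"
  proof -
    interpret shift_prob M by fact
    show ?thesis using clopen_M[OF C] by simp
  qed
  moreover have "(\<lambda>n. integral\<^sup>L (\<mu> n) (indicator C :: _ \<Rightarrow> real)) \<longlonglongrightarrow> integral\<^sup>L \<nu> (indicator C)"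
    using assms(1) \<open>scontinuous (indicator C)\<close> unfolding vague_limit_def by blast
  ultimately show ?thesis using assms(2,3) by simp
qed

section \<open>Equilibrium states and the critical parameter\<close>

context freezing
begin

lemma integral_pot_nonpos: "integral\<^sup>L M (pot a X) \<le> 0"
  using Bochner_Integration.integral_nonneg[of M "\<lambda>x. - pot a X x"] pot_bounds(2) by simp

lemma integral_pot_eq_0_iff:
  assumes "shift_prob M"
  shows "integral\<^sup>L M (pot a X) = 0 \<longleftrightarrow> measure M X = 1"
proof -
  interpret shift_prob M by fact
  have pot0: "pot a X x = 0 \<longleftrightarrow> x \<in> X" for x
    using a_pos[of "exit x"] by (auto simp: pot_eq)
  have "integral\<^sup>L M (pot a X) = 0 \<longleftrightarrow> (\<integral>x. - pot a X x \<partial>M) = 0" by simp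
  also have "\<dots> \<longleftrightarrow> (AE x in M. - pot a X x = 0)"
    using pot_bounds(2) by (intro integral_nonneg_eq_0_iff_AE Bochner_Integration.integrable_minus pot_integrable assms) auto
  also have "\<dots> \<longleftrightarrow> (AE x in M. x \<in> X)" by (simp add: pot0)
  also have "\<dots> \<longleftrightarrow> measure M X = 1"
    using prob_eq_1[of X] X_sets by (simp add: sets_M)
  finally show ?thesis .
qed

text \<open>On \<open>X\<close> the potential integrates to 0, so the pressure bound specializes to
  the upper half of the variational principle for \<open>X\<close>.\<close>

lemma ks_entropy_le_htop:
  assumes "shift_inv M" "measure M X = 1"
  shows "ks_entropy M \<le> htop X"
  using pressure_le[OF assms(1)] integral_pot_eq_0_iff[of M] assms by (simp add: shift_inv_def)

lemma MME_iff: "M \<in> MME X \<longleftrightarrow> shift_inv M \<and> measure M X = 1 \<and> ks_entropy M = htop X"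
proof -
  obtain M0 where M0: "shift_inv M0" "measure M0 X = 1" "htop X \<le> ks_entropy M0"
    using max_entropy_measure by blast
  show ?thesis
  proof
    assume "M \<in> MME X"
    then have M: "shift_inv M" "measure M X = 1" "ks_entropy M0 \<le> ks_entropy M"
      using M0 by (auto simp: MME_def inv_probs_iff)
    then show "shift_inv M \<and> measure M X = 1 \<and> ks_entropy M = htop X"
      using M0(3) ks_entropy_le_htop[OF M(1,2)] by simp
  next
    assume "shift_inv M \<and> measure M X = 1 \<and> ks_entropy M = htop X"
    then show "M \<in> MME X" using ks_entropy_le_htop by (simp add: MME_def inv_probs_iff)
  qed
qed

lemma MME_nonempty: "MME X \<noteq> {}"
  using max_entropy_measure ks_entropy_le_htop MME_iff by (metis antisym empty_iff)

text \<open>The parameters at which the pressure does not exceed that of \<open>X\<close>, namely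
  \<open>htop X\<close>. The infimum of this set will be the critical parameter.\<close>

definition frozen :: "real set" where
  "frozen = {b. \<forall>M. shift_inv M \<longrightarrow> ks_entropy M + b * integral\<^sup>L M (pot a X) \<le> htop X}"

lemma frozen_nonempty: "frozen \<noteq> {}"
  using pressure_le unfolding frozen_def by blast

text \<open>The strict inequality is essential. An equilibrium state at \<open>c\<close> reaches
  \<open>htop X\<close>, while the bound at \<open>b\<close> also applies to it; lowering the
  parameter cannot gain anything, so its potential integrates to 0 and it lives on
  \<open>X\<close>.\<close>

lemma eq_states_beyond_frozen:
  assumes b: "b \<in> frozen" "b < c"
  shows "eq_states c (pot a X) = MME X"
proof (rule set_eqI)
  fix M
  have bnd: "ks_entropy N + b * integral\<^sup>L N (pot a X) \<le> htop X" if "shift_inv N" for N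
    using b(1) that by (simp add: frozen_def)
  have slope: "c * integral\<^sup>L N (pot a X) \<le> b * integral\<^sup>L N (pot a X)" for N
    using b(2) integral_pot_nonpos[of N] by (intro mult_right_mono_neg) auto
  have zero: "integral\<^sup>L N (pot a X) = 0" if "N \<in> MME X" for N
    using that integral_pot_eq_0_iff by (auto simp: MME_iff shift_inv_def)
  show "M \<in> eq_states c (pot a X) \<longleftrightarrow> M \<in> MME X"
  proof
    assume M: "M \<in> MME X"
    then have inv: "shift_inv M" and ent: "ks_entropy M = htop X" by (simp_all add: MME_iff)
    have "ks_entropy N + c * integral\<^sup>L N (pot a X) \<le> htop X" if "shift_inv N" for N
      using bnd[OF that] slope[of N] by linarith
    then show "M \<in> eq_states c (pot a X)"
      by (simp add: eq_states_def inv_probs_iff inv ent zero[OF M])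
  next
    assume M: "M \<in> eq_states c (pot a X)"
    then have inv: "shift_inv M" by (simp add: eq_states_def inv_probs_iff)
    obtain N where N: "N \<in> MME X" using MME_nonempty by blast
    have ge: "htop X \<le> ks_entropy M + c * integral\<^sup>L M (pot a X)"
    proof -
      have "ks_entropy N + c * integral\<^sup>L N (pot a X) \<le> ks_entropy M + c * integral\<^sup>L M (pot a X)"
      proof -
        have "N \<in> inv_probs" using N by (simp add: inv_probs_iff MME_iff)
        then show ?thesis using M unfolding eq_states_def by blast
      qed
      then show ?thesis using N zero[OF N] by (simp add: MME_iff)
    qed
    then have "b * integral\<^sup>L M (pot a X) \<le> c * integral\<^sup>L M (pot a X)"
      using bnd[OF inv] by linarith
    then have "(c - b) * integral\<^sup>L M (pot a X) \<ge> 0" by (simp add: left_diff_distrib)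
    then have "integral\<^sup>L M (pot a X) = 0"
      using b(2) integral_pot_nonpos[of M] by (simp add: zero_le_mult_iff)
    moreover from this have "ks_entropy M = htop X" using ge bnd[OF inv] by simp
    ultimately show "M \<in> MME X"
      using inv integral_pot_eq_0_iff[of M] by (simp add: MME_iff shift_inv_def)
  qed
qed

lemma eq_states_not_frozen:
  assumes "b \<notin> frozen"
  shows "eq_states b (pot a X) \<inter> MME X = {}"
proof -
  obtain N where N: "shift_inv N" "htop X < ks_entropy N + b * integral\<^sup>L N (pot a X)"
    using assms by (auto simp: frozen_def not_le)
  have "M \<notin> eq_states b (pot a X)" if "M \<in> MME X" for M
  proof
    assume "M \<in> eq_states b (pot a X)"
    then have "ks_entropy N + b * integral\<^sup>L N (pot a X) \<le> ks_entropy M + b * integral\<^sup>L M (pot a X)"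
      using N(1) by (simp add: eq_states_def inv_probs_iff)
    moreover have "integral\<^sup>L M (pot a X) = 0" "ks_entropy M = htop X"
      using that integral_pot_eq_0_iff[of M] by (auto simp: MME_iff shift_inv_def)
    ultimately show False using N(2) by simp
  qed
  then show ?thesis by blast
qed

text \<open>A measure of maximal entropy of the full shift shows that no nonpositive parameter is frozen.\<close>

lemma frozen_pos:
  assumes "X \<noteq> UNIV" "b \<in> frozen"
  shows "0 \<le> b"
proof (rule ccontr)
  assume "\<not> 0 \<le> b"
  obtain M :: "(nat \<Rightarrow> 'a) measure" where M: "shift_inv M" "ln (real CARD('a)) \<le> ks_entropy M"
    using ssubshift.max_entropy_measure[OF ssubshift_UNIV] htop_UNIV by metis
  have "0 \<le> b * integral\<^sup>L M (pot a X)"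
    using \<open>\<not> 0 \<le> b\<close> integral_pot_nonpos[of M] by (intro mult_nonpos_nonpos) auto
  moreover have "ks_entropy M + b * integral\<^sup>L M (pot a X) \<le> htop X"
    using assms(2) M(1) by (simp add: frozen_def)
  ultimately show False using M(2) htop_less[OF assms(1)] by linarith
qed

text \<open>The infimum is a real number because \<open>frozen\<close> is nonempty and bounded below
  by 0. Below it the equilibrium states are disjoint from the nonempty set \<open>MME X\<close>, so
  they differ from those above even if there are none.\<close>

lemma freezing_at:
  assumes "X \<noteq> UNIV"
  shows "freezing_phase_transition (pot a X) (Inf frozen)"
    and "c > Inf frozen \<Longrightarrow> eq_states c (pot a X) = MME X"
proof -
  have bdd: "bdd_below frozen" using frozen_pos[OF assms] by (rule bdd_belowI)
  show above: "eq_states c (pot a X) = MME X" if c: "c > Inf frozen" for c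
  proof -
    obtain b where "b \<in> frozen" "b < c" using c frozen_nonempty bdd by (auto simp: cInf_less_iff)
    then show ?thesis by (rule eq_states_beyond_frozen)
  qed
  have "eq_states c (pot a X) \<noteq> MME X" if "c < Inf frozen" for c
  proof -
    have "c \<notin> frozen" using that cInf_lower[OF _ bdd, of c] by fastforce
    then show ?thesis using eq_states_not_frozen[of c] MME_nonempty by auto
  qed
  then show "freezing_phase_transition (pot a X) (Inf frozen)"
    using above unfolding freezing_phase_transition_def by simp
qed

text \<open>Each condition is tested on finitely many letters and then passed to the limit:
  invariance on clopen sets, support through the clopen neighborhoods of \<open>X\<close> given by
  its language, and maximal entropy through the lower bound on every block entropy.\<close>

lemma MME_closed:
  assumes lim: "vague_limit \<mu> \<nu>" and \<nu>: "shift_prob \<nu>" and \<mu>: "\<And>n. shift_prob (\<mu> n)"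
    and mme: "\<forall>\<^sub>F n in sequentially. \<mu> n \<in> MME X"
  shows "\<nu> \<in> MME X"
proof -
  note conv = measure_continuous_vague[OF lim \<nu> \<mu>]
  have inv: "shift_inv \<nu>"
  proof (rule shift_invI[OF \<nu>])
    fix C :: "(nat \<Rightarrow> 'a) set" assume C: "C \<in> clopens"
    have sC: "shift -` C \<in> clopens" using vimage_shift_clopen[OF C, of 1] by simp
    from mme have "\<forall>\<^sub>F n in sequentially. measure (\<mu> n) (shift -` C) = measure (\<mu> n) C"
    proof eventually_elim
      case (elim n)
      then interpret shift_inv "\<mu> n" by (simp add: MME_iff)
      show ?case using invariant[OF clopen_sets[OF C]] by (simp add: measure_def)
    qed
    then have "(\<lambda>n. measure (\<mu> n) C) \<longlonglongrightarrow> measure \<nu> (shift -` C)"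
      by (rule Lim_transform_eventually[OF conv[OF sC]])
    then show "measure \<nu> (shift -` C) = measure \<nu> C" using conv[OF C] LIMSEQ_unique by blast
  qed
  interpret shift_inv \<nu> by fact
  have "measure \<nu> X = 1"
  proof (rule measure_X_eq_1[OF \<nu>])
    fix m
    from mme have "\<forall>\<^sub>F n in sequentially. measure (\<mu> n) {x. prefix m x \<in> lang m X} = 1"
    proof eventually_elim
      case (elim n)
      then interpret N: shift_inv "\<mu> n" by (simp add: MME_iff)
      have "1 = measure (\<mu> n) X" using elim by (simp add: MME_iff)
      also have "\<dots> \<le> measure (\<mu> n) {x. prefix m x \<in> lang m X}"
        using in_iff_prefix by (intro N.finite_measure_mono N.clopen_M clopen_lang) blast
      finally show ?case using N.prob_le_1 by (intro antisym) auto
    qed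
    then have "(\<lambda>n. 1) \<longlonglongrightarrow> measure \<nu> {x. prefix m x \<in> lang m X}"
      by (rule Lim_transform_eventually[OF conv[OF clopen_lang]])
    then show "measure \<nu> {x. prefix m x \<in> lang m X} = 1" using LIMSEQ_unique[OF _ tendsto_const] by blast
  qed
  moreover have "htop X \<le> ks_entropy \<nu>"
  proof (rule ks_entropy_ge)
    fix m :: nat assume m: "m \<ge> 1"
    have cyl: "prefix m -` {v} \<in> clopens" for v :: "'a list"
      using depends_prefix[of m "{v}"] unfolding clopens_def vimage_def by blast
    have "(\<lambda>n. \<Sum>v\<in>words m. eta (measure (\<mu> n) (prefix m -` {v}))) \<longlonglongrightarrow> (\<Sum>v\<in>words m. eta (measure \<nu> (prefix m -` {v})))"
      by (intro tendsto_sum tendsto_eta conv cyl) auto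
    then have "(\<lambda>n. ent (\<mu> n) (prefix m)) \<longlonglongrightarrow> ent \<nu> (prefix m)"
      by (simp only: shift_prob.ent_prefix[OF \<mu>] ent_prefix)
    moreover from mme have "\<forall>\<^sub>F n in sequentially. htop X * real m \<le> ent (\<mu> n) (prefix m)"
    proof eventually_elim
      case (elim n)
      then show ?case using shift_inv.ks_entropy_le[of "\<mu> n" m] m by (simp add: MME_iff field_simps)
    qed
    ultimately show "htop X * real m \<le> ent \<nu> (prefix m)"
      by (rule tendsto_lowerbound) simp
  qed
  ultimately show ?thesis using inv ks_entropy_le_htop[OF inv] by (simp add: MME_iff)
qed

lemma ZTA_subset:
  assumes "X \<noteq> UNIV"
  shows "ZTA (pot a X) \<subseteq> MME X"
proof
  fix \<nu> assume "\<nu> \<in> ZTA (pot a X)"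
  then obtain \<beta> \<mu> where \<nu>: "shift_prob \<nu>" and \<beta>: "filterlim \<beta> at_top sequentially"
    and \<mu>: "\<And>n. \<mu> n \<in> eq_states (\<beta> n) (pot a X)" and lim: "vague_limit \<mu> \<nu>"
    by (auto simp: ZTA_def shift_prob_def shift_prob_axioms_def)
  \<comment> \<open>From some index on, the approximating states are themselves measures of maximal
    entropy of \<open>X\<close>, so only closedness of that set remains.\<close>
  have "\<forall>\<^sub>F n in sequentially. Inf frozen < \<beta> n"
    using \<beta> by (simp add: filterlim_at_top_dense)
  then have "\<forall>\<^sub>F n in sequentially. \<mu> n \<in> MME X"
    by eventually_elim (use \<mu> freezing_at(2)[OF assms] in blast)
  moreover have "shift_prob (\<mu> n)" for n
    using \<mu>[of n] by (simp add: eq_states_def inv_probs_iff shift_inv_def)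
  ultimately show "\<nu> \<in> MME X" by (intro MME_closed[OF lim \<nu>])
qed

end

theorem theorem5p3:
  fixes X0 :: "(nat \<Rightarrow> 'a::finite) set" and a :: "nat \<Rightarrow> real"
  assumes "subshift X0" and "X0 \<noteq> UNIV"
    and "decseq a"
    and "\<And>j. j \<ge> 1 \<Longrightarrow> a (3 * j) \<ge> 2 * ln (real j) / real j
           + (1 / real j) * (\<Sum>i = 0..nat \<lfloor>log 2 (real j)\<rfloor>. 2 ^ i * kappa X0 i)
           + 1 / real j"
  shows "(\<exists>\<beta>c. freezing_phase_transition (pot a X0) \<beta>c) \<and> ZTA (pot a X0) \<subseteq> MME X0"
proof -
  interpret freezing X0 a
    by (intro freezing.intro ssubshift.intro freezing_axioms.intro assms)
  show ?thesis using freezing_at(1)[OF assms(2)] ZTA_subset[OF assms(2)] by blast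
qed

end
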